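(* Let $$A=\bigoplus_{i\in I}B(H_{\mathrm{in},i}),\quad B=\bigoplus_{j\in J}B(H_{\mathrm{out},j}),\quad C=\bigoplus_{k\in K}B(K_{\mathrm{in},k}),\quad D=\bigoplus_{l\in L}B(K_{\mathrm{out},l}),$$ and let $\mathcal S:\underline{\mathrm{Hom}}(A,B)\to\underline{\mathrm{Hom}}(C,D)$ be a deterministic supermap. Then there exist - a finite-dimensional Hilbert space $P$ with $\dim P\le \max_{i\in I,\,k\in K}\dim(H_{\mathrm{in},i})\dim(K_{\mathrm{in},k})$, - a channel $\mathcal E: C\to A\otimes B(P)=\bigoplus_{i\in I}B(H_{\mathrm{in},i}\otimes P)$, and - a channel $\mathcal G:\bigoplus_{(i,k,j)\in I\times K\times J}B(H_{\mathrm{out},j}\otimes P)\to D$ (that is, $\mathcal G:\bigoplus_{i\in I,k\in K}B\otimes B(P)\to D$), with the following property. For every channel $\mathcal F:A\to B$, let $\mathcal S(\mathcal F):C\to D$ denote the channel whose Choi operator is $\mathcal S(J(\mathcal F))$. Then for every $\rho=(\rho_k)_{k\in K}\in C$, $$\mathcal S(\mathcal F)(\rho)=\mathcal G(\omega),\qquad \omega_{(i,k,j)}:=\Big[(\mathcal F\otimes \mathrm{id}_{B(P)})\big(\iota_i\,\pi_i\,\mathcal E(\iota_k\rho_k)\big)\Big]_j\in B(H_{\mathrm{out},j}\otimes P).$$ Here $\iota_k\rho_k\in C$ is the element whose $k$-th block is $\rho_k$ and whose other blocks are $0$; $\pi_i$ extracts the $i$-th block $\in B(H_{\mathrm{in},i}\otimes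 P)$ of an element of $A\otimes B(P)$; $\iota_i$ re-embeds it into $A\otimes B(P)$ as the element supported on block $i$; and $[\,\cdot\,]_j$ is the $j$-th block of an element of $B\otimes B(P)=\bigoplus_j B(H_{\mathrm{out},j}\otimes P)$. Operationally: the classical input $k$ is copied; one copy with $\rho_k$ is fed into $\mathcal E$; the classical outcome $i$ of $\mathcal E$ is copied; one copy together with the $B(H_{\mathrm{in},i})$-part is fed into $\mathcal F$; and $\mathcal G$ receives $i,k$, the classical output $j$ of $\mathcal F$, and the quantum system $H_{\mathrm{out},j}\otimes P$.
   Context: Throughout, all Hilbert spaces are finite-dimensional and nonzero, and all index sets are finite and nonempty. **Multimatrix algebras.** A finite-dimensional $C^*$-algebra is written as $A=\bigoplus_{i\in I}B(H_i)$, with elements $X=(X_i)_{i\in I}$. Its trace is $\mathrm{Tr}(X)=\sum_i\mathrm{Tr}(X_i)$, and $X\ge 0$ means every block is positive semidefinite. A *state* of $A$ is a positive element of trace $1$. A *channel* $A\to B$ is a completely positive trace-preserving linear map. **Choi operators and (TP).** For $A=\bigoplus_{i\in I}B(H_i)$ and $B=\bigoplus_{j\in J}B(K_j)$, set $$\underline{\mathrm{Hom}}(A,B):=\bigoplus_{(j,i)\in J\times I}B(K_j\otimes H_i).$$ The Choi operator of a linear map $\mathcal F:A\to B$ is $J(\mathcal F)\in\underline{\mathrm{Hom}}(A,B)$ with $$J(\mathcal F)_{ji}=\sum_{a,b}\mathcal F(e^{(i)}_{ab})_j\otimes e^{(i)}_{ab},$$ where $e^{(i)}_{ab}$ are matrix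 units of $B(H_i)$ for a fixed orthonormal basis, regarded as elements of $A$ supported on block $i$, and $Y_j$ denotes the $j$-th block of $Y\in B$. - $\mathcal F\mapsto J(\mathcal F)$ is a linear bijection. - $\mathcal F$ is completely positive iff $J(\mathcal F)\ge 0$. - An element $X\in\underline{\mathrm{Hom}}(A,B)$ satisfies **(TP)** if $\sum_{j\in J}\mathrm{Tr}_{K_j}(X_{ji})=1_{H_i}$ for every $i\in I$. - A CP map is trace-preserving iff its Choi operator satisfies (TP). Hence the positive elements satisfying (TP) are exactly the Choi operators of channels. **Deterministic supermaps.** A deterministic supermap from channels $A\to B$ to channels $C\to D$ is a completely positive linear map $\mathcal S:\underline{\mathrm{Hom}}(A,B)\to\underline{\mathrm{Hom}}(C,D)$ that sends every positive element satisfying (TP) to an element satisfying (TP). *)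

theory Defs
  imports Complex_Main "Jordan_Normal_Form.Matrix"
begin

text \<open>A multimatrix algebra with (finite, nonempty) index type 'i and block dimensions
  d :: 'i => nat is represented by functions X :: 'i => complex mat with
  X i a d i x d i matrix.  The Hilbert space of dimension n is C^n.
  Tensor products H (x) K use the index (a,b) |-> a * dim K + b.\<close>

definition elem :: "('i \<Rightarrow> nat) \<Rightarrow> ('i \<Rightarrow> complex mat) \<Rightarrow> bool" where
  "elem d X \<longleftrightarrow> (\<forall>i. X i \<in> carrier_mat (d i) (d i))"

definition psd :: "nat \<Rightarrow> complex mat \<Rightarrow> bool" where
  "psd n M \<longleftrightarrow> M \<in> carrier_mat n n \<and>
     (\<forall>v :: nat \<Rightarrow> complex.
        let z = (\<Sum>a<n. \<Sum>b<n. cnj (v a) * M $$ (a, b) * v b) in Im z = 0 \<and> Re z \<ge> 0)"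

definition elem_pos :: "('i \<Rightarrow> nat) \<Rightarrow> ('i \<Rightarrow> complex mat) \<Rightarrow> bool" where
  "elem_pos d X \<longleftrightarrow> elem d X \<and> (\<forall>i. psd (d i) (X i))"

definition tr_elem :: "('i::finite \<Rightarrow> nat) \<Rightarrow> ('i \<Rightarrow> complex mat) \<Rightarrow> complex" where
  "tr_elem d X = (\<Sum>i\<in>UNIV. \<Sum>a<d i. X i $$ (a, a))"

definition lin_map :: "('i \<Rightarrow> nat) \<Rightarrow> ('j \<Rightarrow> nat) \<Rightarrow>
    (('i \<Rightarrow> complex mat) \<Rightarrow> ('j \<Rightarrow> complex mat)) \<Rightarrow> bool" where
  "lin_map d d' F \<longleftrightarrow>
     (\<forall>X. elem d X \<longrightarrow> elem d' (F X)) \<and>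
     (\<forall>X Y. elem d X \<longrightarrow> elem d Y \<longrightarrow> F (\<lambda>i. X i + Y i) = (\<lambda>j. F X j + F Y j)) \<and>
     (\<forall>c X. elem d X \<longrightarrow> F (\<lambda>i. c \<cdot>\<^sub>m X i) = (\<lambda>j. c \<cdot>\<^sub>m F X j))"

definition subblock :: "nat \<Rightarrow> nat \<Rightarrow> nat \<Rightarrow> nat \<Rightarrow> complex mat \<Rightarrow> complex mat" where
  "subblock n m p q M = mat n n (\<lambda>(a, b). M $$ (a * m + p, b * m + q))"

definition tensor_id :: "('i \<Rightarrow> nat) \<Rightarrow> ('j \<Rightarrow> nat) \<Rightarrow> nat \<Rightarrow>
    (('i \<Rightarrow> complex mat) \<Rightarrow> ('j \<Rightarrow> complex mat)) \<Rightarrow> ('i \<Rightarrow> complex mat) \<Rightarrow> ('j \<Rightarrow> complex mat)" where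
  "tensor_id d d' m F X = (\<lambda>j. mat (d' j * m) (d' j * m)
     (\<lambda>(r, s). F (\<lambda>i. subblock (d i) m (r mod m) (s mod m) (X i)) j $$ (r div m, s div m)))"

definition comp_pos :: "('i \<Rightarrow> nat) \<Rightarrow> ('j \<Rightarrow> nat) \<Rightarrow>
    (('i \<Rightarrow> complex mat) \<Rightarrow> ('j \<Rightarrow> complex mat)) \<Rightarrow> bool" where
  "comp_pos d d' F \<longleftrightarrow> (\<forall>m>0. \<forall>X. elem_pos (\<lambda>i. d i * m) X \<longrightarrow>
       elem_pos (\<lambda>j. d' j * m) (tensor_id d d' m F X))"

definition trace_pres :: "('i::finite \<Rightarrow> nat) \<Rightarrow> ('j::finite \<Rightarrow> nat) \<Rightarrow>
    (('i \<Rightarrow> complex mat) \<Rightarrow> ('j \<Rightarrow> complex mat)) \<Rightarrow> bool" where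
  "trace_pres d d' F \<longleftrightarrow> (\<forall>X. elem d X \<longrightarrow> tr_elem d' (F X) = tr_elem d X)"

definition channel :: "('i::finite \<Rightarrow> nat) \<Rightarrow> ('j::finite \<Rightarrow> nat) \<Rightarrow>
    (('i \<Rightarrow> complex mat) \<Rightarrow> ('j \<Rightarrow> complex mat)) \<Rightarrow> bool" where
  "channel d d' F \<longleftrightarrow> lin_map d d' F \<and> comp_pos d d' F \<and> trace_pres d d' F"

text \<open>Block dimensions of Hom(A,B) = (+)_{(j,i)} B(K_j (x) H_i).\<close>
definition homdim :: "('i \<Rightarrow> nat) \<Rightarrow> ('j \<Rightarrow> nat) \<Rightarrow> ('j \<times> 'i \<Rightarrow> nat)" where
  "homdim d d' = (\<lambda>(j, i). d' j * d i)"

definition munit :: "('i \<Rightarrow> nat) \<Rightarrow> 'i \<Rightarrow> nat \<Rightarrow> nat \<Rightarrow> ('i \<Rightarrow> complex mat)" where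
  "munit d i a b = (\<lambda>i'. if i' = i then mat (d i) (d i) (\<lambda>(x, y). if x = a \<and> y = b then 1 else 0)
                         else 0\<^sub>m (d i') (d i'))"

text \<open>Choi operator: J(F)_{ji} = sum_{a,b} F(e^(i)_ab)_j (x) e^(i)_ab, written entrywise.\<close>
definition choi :: "('i \<Rightarrow> nat) \<Rightarrow> ('j \<Rightarrow> nat) \<Rightarrow>
    (('i \<Rightarrow> complex mat) \<Rightarrow> ('j \<Rightarrow> complex mat)) \<Rightarrow> ('j \<times> 'i \<Rightarrow> complex mat)" where
  "choi d d' F = (\<lambda>(j, i). mat (d' j * d i) (d' j * d i)
     (\<lambda>(r, s). F (munit d i (r mod d i) (s mod d i)) j $$ (r div d i, s div d i)))"

text \<open>Condition (TP): sum_j Tr_{K_j}(X_{ji}) = 1_{H_i} for all i, written entrywise.\<close>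
definition TP_cond :: "('i \<Rightarrow> nat) \<Rightarrow> ('j::finite \<Rightarrow> nat) \<Rightarrow> ('j \<times> 'i \<Rightarrow> complex mat) \<Rightarrow> bool" where
  "TP_cond d d' X \<longleftrightarrow> (\<forall>i. \<forall>a<d i. \<forall>b<d i.
     (\<Sum>j\<in>UNIV. \<Sum>c<d' j. X (j, i) $$ (c * d i + a, c * d i + b)) = (if a = b then 1 else 0))"

definition det_supermap :: "('i::finite \<Rightarrow> nat) \<Rightarrow> ('j::finite \<Rightarrow> nat) \<Rightarrow>
    ('k::finite \<Rightarrow> nat) \<Rightarrow> ('l::finite \<Rightarrow> nat) \<Rightarrow>
    (('j \<times> 'i \<Rightarrow> complex mat) \<Rightarrow> ('l \<times> 'k \<Rightarrow> complex mat)) \<Rightarrow> bool" where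
  "det_supermap dA dB dC dD S \<longleftrightarrow>
     lin_map (homdim dA dB) (homdim dC dD) S \<and>
     comp_pos (homdim dA dB) (homdim dC dD) S \<and>
     (\<forall>X. elem_pos (homdim dA dB) X \<and> TP_cond dA dB X \<longrightarrow> TP_cond dC dD (S X))"

definition inj_block :: "('i \<Rightarrow> nat) \<Rightarrow> 'i \<Rightarrow> complex mat \<Rightarrow> ('i \<Rightarrow> complex mat)" where
  "inj_block d i M = (\<lambda>i'. if i' = i then M else 0\<^sub>m (d i') (d i'))"

end

theory Submission
  imports Defs "HOL-Library.Complex_Order"
begin

text \<open>
  Let \<open>M\<close> be the Choi operator of \<open>S\<close>, with positive blocks \<open>M\<^sub>l\<^sub>k\<^sub>j\<^sub>i\<close> on
  \<open>K\<^sub>o\<^sub>u\<^sub>t\<^sub>,\<^sub>l \<otimes> H\<^sub>o\<^sub>u\<^sub>t\<^sub>,\<^sub>j \<otimes> K\<^sub>i\<^sub>n\<^sub>,\<^sub>k \<otimes> H\<^sub>i\<^sub>n\<^sub>,\<^sub>i\<close>. Since \<open>S\<close> preserves (TP), the functionals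
  obtained by tracing out the output of \<open>S(X)\<close> are constant on channels, and therefore see only the
  marginal of \<open>X\<close>: tracing \<open>K\<^sub>o\<^sub>u\<^sub>t\<close> out of \<open>M\<close> leaves \<open>1 \<otimes> R\<^sub>k\<^sub>i\<close>, where \<open>R\<^sub>k\<^sub>i\<close> does not depend on \<open>j\<close> and
  is the Choi operator of the first half of the comb. A rank factorization \<open>R = w w\<^sup>*\<close> with left inverse
  \<open>v w = 1\<close> provides the channel \<open>E\<close>, whose Kraus operators are the \<open>w\<^sub>k\<^sub>i\<close>, while \<open>v M v\<^sup>*\<close>, completed to a
  trace-preserving map, is the Choi operator of \<open>G\<close>. As \<open>R\<^sub>k\<^sub>i\<close> acts on a space of dimension
  \<open>dim K\<^sub>i\<^sub>n\<^sub>,\<^sub>k \<cdot> dim H\<^sub>i\<^sub>n\<^sub>,\<^sub>i\<close>, the maximum of these dimensions suffices for \<open>P\<close>.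
\<close>

section \<open>Positive semidefinite kernels\<close>

text \<open>Kernels on arbitrary index sets let tensor factors be products of sets, without
  flattened indices. In the order on complex numbers, \<open>0 \<le>\<close> states both that the
  value is real and that it is nonnegative.\<close>

definition psd_form :: "'x set \<Rightarrow> ('x \<Rightarrow> 'x \<Rightarrow> complex) \<Rightarrow> bool" where
  "psd_form A K \<longleftrightarrow> (\<forall>v. 0 \<le> (\<Sum>x\<in>A. \<Sum>y\<in>A. cnj (v x) * K x y * v y))"

lemma psd_formD: "psd_form A K \<Longrightarrow> 0 \<le> (\<Sum>x\<in>A. \<Sum>y\<in>A. cnj (v x) * K x y * v y)"
  by (simp add: psd_form_def)

lemma psd_iff_psd_form:
  "psd n M \<longleftrightarrow> M \<in> carrier_mat n n \<and> psd_form {..<n} (\<lambda>a b. M $$ (a, b))"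
  by (auto simp: psd_def psd_form_def Let_def less_eq_complex_def)

lemma psd_form_cong:
  assumes "\<And>x y. x \<in> A \<Longrightarrow> y \<in> A \<Longrightarrow> K x y = L x y"
  shows "psd_form A K \<longleftrightarrow> psd_form A L"
  using assms by (simp add: psd_form_def cong: sum.cong)

lemma psd_form_subset:
  assumes "finite B" "A \<subseteq> B" "psd_form B K"
  shows "psd_form A K"
  unfolding psd_form_def
proof
  fix v :: "'a \<Rightarrow> complex"
  define u where "u x = (if x \<in> A then v x else 0)" for x
  have "(\<Sum>x\<in>A. \<Sum>y\<in>A. cnj (v x) * K x y * v y) = (\<Sum>x\<in>B. \<Sum>y\<in>B. cnj (u x) * K x y * u y)"
    by (intro sum.mono_neutral_cong_left assms ballI) (auto simp: u_def)
  then show "0 \<le> (\<Sum>x\<in>A. \<Sum>y\<in>A. cnj (v x) * K x y * v y)"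
    using psd_formD[OF assms(3)] by simp
qed

lemma psd_form_diag:
  assumes "finite A" "psd_form A K" "x \<in> A"
  shows "0 \<le> K x x"
  using psd_formD[OF psd_form_subset[of A "{x}" K], of "\<lambda>_. 1"] assms by simp

lemma psd_form_pair:
  assumes "finite A" "psd_form A K" "x \<in> A" "y \<in> A" "x \<noteq> y"
  shows "0 \<le> cnj p * K x x * p + cnj p * K x y * q + cnj q * K y x * p + cnj q * K y y * q"
  using psd_formD[OF psd_form_subset[of A "{x, y}" K], of "\<lambda>z. if z = x then p else q"] assms
  by (simp add: algebra_simps)

lemma psd_form_hermitian:
  assumes "finite A" "psd_form A K" "x \<in> A" "y \<in> A"
  shows "K y x = cnj (K x y)"
proof (cases "x = y")
  case True
  then show ?thesis
    using psd_form_diag[OF assms(1-3)] by (simp add: complex_eq_iff less_eq_complex_def)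
next
  case False
  have d: "Im (K x x) = 0" "Im (K y y) = 0"
    using psd_form_diag[OF assms(1,2)] assms(3,4) by (auto simp: less_eq_complex_def)
  \<comment> \<open>The form is real at (1, 1) and at (1, i): the first makes the imaginary parts of
    \<open>K x y\<close> and \<open>K y x\<close> opposite, the second makes their real parts
    equal.\<close>
  show ?thesis
    using psd_form_pair[OF assms False, of 1 1] psd_form_pair[OF assms False, of 1 \<i>] d
    by (simp add: complex_eq_iff less_eq_complex_def)
qed

text \<open>Testing with the vector whose coordinates at \<open>x\<close> and \<open>y\<close> are
  -s \<open>K x y\<close> and 1 bounds 2 s |K x y|^2 by \<open>K y y\<close> for every real s, which
  is impossible unless \<open>K x y\<close> is 0.\<close>

lemma psd_form_zero_diag:
  assumes "finite A" "psd_form A K" "x \<in> A" "y \<in> A" "K x x = 0"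
  shows "K x y = 0"
proof (cases "x = y")
  case False
  have le: "2 * s * (cmod (K x y))\<^sup>2 \<le> Re (K y y)" for s :: real
  proof -
    define p where "p = - of_real s * K x y"
    have n: "(of_real (cmod z))\<^sup>2 = z * cnj z" for z
      using complex_norm_square[of z] by simp
    have "cnj p * K x y = - of_real (s * (cmod (K x y))\<^sup>2)"
      by (simp add: p_def n)
    moreover have "cnj (K x y) * p = - of_real (s * (cmod (K x y))\<^sup>2)"
      by (simp add: p_def n)
    moreover have "0 \<le> cnj p * K x y + cnj (K x y) * p + K y y"
      using psd_form_pair[OF assms(1-4) False, of p 1] psd_form_hermitian[OF assms(1-4)] assms(5)
      by simp
    ultimately have "0 \<le> Re (- of_real (s * (cmod (K x y))\<^sup>2) + - of_real (s * (cmod (K x y))\<^sup>2) + K y y)"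
      by (simp only: less_eq_complex_def) simp
    then show ?thesis by simp
  qed
  show ?thesis
  proof (rule ccontr)
    assume "K x y \<noteq> 0"
    \<comment> \<open>The value of s is chosen so that the right-hand side is Re (K y y) +
      1.\<close>
    then have "Re (K y y) < 2 * ((Re (K y y) + 1) / (2 * (cmod (K x y))\<^sup>2)) * (cmod (K x y))\<^sup>2"
      by simp
    with le show False by (meson not_le)
  qed
qed (use assms in simp)

text \<open>Completing the square: for fixed \<open>v\<close> on \<open>A\<close>, the coordinate at
  \<open>x0\<close> is chosen to minimise the form of \<open>K\<close>, and the minimum is the form
  of the Schur complement.\<close>

lemma psd_form_schur_complement:
  assumes fin: "finite A" "x0 \<notin> A" and psd: "psd_form (insert x0 A) K" and nz: "K x0 x0 \<noteq> 0"
  shows "psd_form A (\<lambda>x y. K x y - K x x0 * K x0 y / K x0 x0)"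
  unfolding psd_form_def
proof
  fix v :: "'a \<Rightarrow> complex"
  define s where "s = (\<Sum>y\<in>A. K x0 y * v y)"
  define p where "p = - s / K x0 x0"
  define u where "u = v(x0 := p)"
  note herm = psd_form_hermitian[OF _ psd, OF finite.insertI[OF fin(1)]]
  have cs: "(\<Sum>x\<in>A. cnj (v x) * K x x0) = cnj s"
    unfolding s_def cnj_sum
  proof (rule sum.cong[OF refl])
    fix x assume "x \<in> A"
    then show "cnj (v x) * K x x0 = cnj (K x0 x * v x)"
      using herm[of x0 x] by simp
  qed
  have u: "u x = v x" if "x \<in> A" for x using that fin by (auto simp: u_def)
  have real: "cnj (K x0 x0) = K x0 x0" using herm[OF insertI1 insertI1] by (rule sym)
  have "(\<Sum>x\<in>insert x0 A. \<Sum>y\<in>insert x0 A. cnj (u x) * K x y * u y)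
      = cnj p * K x0 x0 * p + cnj p * s + (\<Sum>x\<in>A. cnj (v x) * K x x0) * p
        + (\<Sum>x\<in>A. \<Sum>y\<in>A. cnj (v x) * K x y * v y)"
    using fin by (simp add: sum.distrib u s_def sum_distrib_left sum_distrib_right algebra_simps
        cong: sum.cong) (simp add: u_def mult.left_commute)
  also have "\<dots> = (\<Sum>x\<in>A. \<Sum>y\<in>A. cnj (v x) * K x y * v y) - cnj s * s / K x0 x0"
    unfolding cs using nz by (simp add: p_def real field_simps)
  also have "cnj s * s = (\<Sum>x\<in>A. \<Sum>y\<in>A. cnj (v x) * K x x0 * (K x0 y * v y))"
    unfolding cs[symmetric] unfolding s_def by (rule sum_product)
  also have "(\<Sum>x\<in>A. \<Sum>y\<in>A. cnj (v x) * K x y * v y) - \<dots> / K x0 x0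
     = (\<Sum>x\<in>A. \<Sum>y\<in>A. cnj (v x) * (K x y - K x x0 * K x0 y / K x0 x0) * v y)"
    by (simp add: sum_divide_distrib sum_subtractf algebra_simps)
  finally show "0 \<le> (\<Sum>x\<in>A. \<Sum>y\<in>A. cnj (v x) * (K x y - K x x0 * K x0 y / K x0 x0) * v y)"
    using psd_formD[OF psd, of u] by (simp only:)
qed

text \<open>Cholesky elimination over the index set: one column is split off at each nonzero pivot,
  so the columns stay linearly independent and \<open>r\<close> is the rank. The left inverse
  \<open>v\<close> is built along with \<open>w\<close>; it later compresses the kernel of the
  supermap onto the memory.\<close>

lemma psd_form_rank_factorization:
  assumes "finite A" "psd_form A K"
  shows "\<exists>r w v. r \<le> card A \<and> (\<forall>x\<in>A. \<forall>y\<in>A. K x y = (\<Sum>c<r. w c x * cnj (w c y))) \<and>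
     (\<forall>c<r. \<forall>e<r. (\<Sum>x\<in>A. v c x * w e x) = (if c = e then 1 else 0))"
  using assms
proof (induction A arbitrary: K rule: finite_induct)
  case empty
  show ?case by (intro exI[of _ 0]) simp
next
  case (insert x0 A)
  note fin = finite.insertI[OF insert.hyps(1), of x0]
  note herm = psd_form_hermitian[OF fin insert.prems]
  show ?case
  proof (cases "K x0 x0 = 0")
    case True
    \<comment> \<open>A zero pivot forces its whole row and column to vanish, so \<open>x0\<close>
      adds no column.\<close>
    have z: "K x0 y = 0" "K y x0 = 0" if "y \<in> insert x0 A" for y
      using psd_form_zero_diag[OF fin insert.prems _ that True] herm[OF _ that, of x0] by auto
    obtain r w v where *: "r \<le> card A" "\<forall>x\<in>A. \<forall>y\<in>A. K x y = (\<Sum>c<r. w c x * cnj (w c y))"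
      "\<forall>c<r. \<forall>e<r. (\<Sum>x\<in>A. v c x * w e x) = (if c = e then 1 else 0)"
      using insert.IH[OF psd_form_subset[OF fin _ insert.prems]] by blast
    show ?thesis
    proof (intro exI conjI)
      show "r \<le> card (insert x0 A)" using * insert.hyps by simp
      show "\<forall>x\<in>insert x0 A. \<forall>y\<in>insert x0 A. K x y =
          (\<Sum>c<r. (if x = x0 then 0 else w c x) * cnj (if y = x0 then 0 else w c y))"
        using * z insert.hyps by (auto intro!: sum.cong)
      have "(\<Sum>x\<in>A. v c x * (if x = x0 then 0 else w e x)) = (\<Sum>x\<in>A. v c x * w e x)" for c e
        by (rule sum.cong) (use insert.hyps in auto)
      then show "\<forall>c<r. \<forall>e<r. (\<Sum>x\<in>insert x0 A. v c x * (if x = x0 then 0 else w e x)) =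
          (if c = e then 1 else 0)"
        using * insert.hyps by simp
    qed
  next
    case False
    define d where "d = sqrt (Re (K x0 x0))"
    have d: "d > 0" "K x0 x0 = of_real d * of_real d"
      using psd_form_diag[OF fin insert.prems, of x0] False
      by (auto simp: d_def less_eq_complex_def complex_eq_iff)
    obtain r w v where *: "r \<le> card A"
      "\<forall>x\<in>A. \<forall>y\<in>A. K x y - K x x0 * K x0 y / K x0 x0 = (\<Sum>c<r. w c x * cnj (w c y))"
      "\<forall>c<r. \<forall>e<r. (\<Sum>x\<in>A. v c x * w e x) = (if c = e then 1 else 0)"
      using insert.IH[OF psd_form_schur_complement[OF insert.hyps insert.prems False]] by blast
    \<comment> \<open>The new column 0 is the pivot column divided by the square root of the pivot;
      the older columns are extended by 0 at \<open>x0\<close>.\<close>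
    define w' where "w' c x = (case c of 0 \<Rightarrow> K x x0 / of_real d
        | Suc c' \<Rightarrow> if x = x0 then 0 else w c' x)" for c x
    \<comment> \<open>Only column 0 is nonzero at \<open>x0\<close>, so evaluation at
      \<open>x0\<close> divided by \<open>d\<close> is dual to it. The older functionals are changed
      at \<open>x0\<close> alone, so as to annihilate column 0.\<close>
    define v' where "v' c x = (case c of 0 \<Rightarrow> if x = x0 then 1 / of_real d else 0
        | Suc c' \<Rightarrow> if x = x0 then - (\<Sum>z\<in>A. v c' z * w' 0 z) / of_real d else v c' x)" for c x
    have ne: "x \<noteq> x0" if "x \<in> A" for x using that insert.hyps by auto
    have W: "w' 0 x0 = of_real d" "w' (Suc e) x0 = 0" for e using d by (auto simp: w'_def)
    have WA: "w' (Suc e) x = w e x" if "x \<in> A" for e x using ne[OF that] by (simp add: w'_def)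
    have V: "v' 0 x0 = 1 / of_real d" "v' (Suc c) x0 = - (\<Sum>z\<in>A. v c z * w' 0 z) / of_real d" for c
      by (auto simp: v'_def)
    have VA: "v' 0 x = 0" "v' (Suc c) x = v c x" if "x \<in> A" for c x
      using ne[OF that] by (auto simp: v'_def)
    show ?thesis
    proof (intro exI conjI ballI allI impI)
      show "Suc r \<le> card (insert x0 A)" using * insert.hyps by simp
      fix x y assume xy: "x \<in> insert x0 A" "y \<in> insert x0 A"
      have 0: "w' 0 x * cnj (w' 0 y) = K x x0 * K x0 y / K x0 x0"
        using herm[OF xy(2), of x0] d by (simp add: w'_def)
      have "(\<Sum>c<Suc r. w' c x * cnj (w' c y)) = K x x0 * K x0 y / K x0 x0
          + (\<Sum>c<r. w' (Suc c) x * cnj (w' (Suc c) y))"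
        unfolding sum.lessThan_Suc_shift 0 ..
      also have "(\<Sum>c<r. w' (Suc c) x * cnj (w' (Suc c) y)) = K x y - K x x0 * K x0 y / K x0 x0"
      proof (cases "x \<in> A \<and> y \<in> A")
        case True
        then show ?thesis using * by (simp add: WA)
      next
        case F: False
        then show ?thesis using xy False by (auto simp: W)
      qed
      finally show "K x y = (\<Sum>c<Suc r. w' c x * cnj (w' c y))" by simp
    next
      fix c e assume ce: "c < Suc r" "e < Suc r"
      have S: "(\<Sum>x\<in>insert x0 A. v' c x * w' e x) = v' c x0 * w' e x0 + (\<Sum>x\<in>A. v' c x * w' e x)"
        using insert.hyps by simp
      show "(\<Sum>x\<in>insert x0 A. v' c x * w' e x) = (if c = e then 1 else 0)"
        unfolding S
        by (cases c; cases e) (use d(1) * ce in \<open>simp_all add: V VA W WA\<close>)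
    qed
  qed
qed

section \<open>Gram kernels and operations that preserve positivity\<close>

lemma gram_form_eq:
  assumes "\<And>x y. x \<in> A \<Longrightarrow> y \<in> A \<Longrightarrow> K x y = (\<Sum>c\<in>I. w c x * cnj (w c y))"
  shows "(\<Sum>x\<in>A. \<Sum>y\<in>A. cnj (v x) * K x y * v y)
    = (\<Sum>c\<in>I. cnj (\<Sum>x\<in>A. cnj (w c x) * v x) * (\<Sum>y\<in>A. cnj (w c y) * v y))"
proof -
  have "(\<Sum>x\<in>A. \<Sum>y\<in>A. cnj (v x) * K x y * v y)
    = (\<Sum>x\<in>A. \<Sum>y\<in>A. \<Sum>c\<in>I. (w c x * cnj (v x)) * (cnj (w c y) * v y))"
    by (intro sum.cong refl) (simp add: assms sum_distrib_left sum_distrib_right mult_ac)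
  also have "\<dots> = (\<Sum>x\<in>A. \<Sum>c\<in>I. \<Sum>y\<in>A. (w c x * cnj (v x)) * (cnj (w c y) * v y))"
    by (intro sum.cong refl sum.swap)
  also have "\<dots> = (\<Sum>c\<in>I. \<Sum>x\<in>A. \<Sum>y\<in>A. (w c x * cnj (v x)) * (cnj (w c y) * v y))"
    by (rule sum.swap)
  also have "\<dots> = (\<Sum>c\<in>I. cnj (\<Sum>x\<in>A. cnj (w c x) * v x) * (\<Sum>y\<in>A. cnj (w c y) * v y))"
    by (simp add: sum_product)
  finally show ?thesis .
qed

lemma cnj_mult_self_nonneg: "0 \<le> cnj z * z"
  by (simp add: less_eq_complex_def)

lemma psd_form_gram:
  assumes "\<And>x y. x \<in> A \<Longrightarrow> y \<in> A \<Longrightarrow> K x y = (\<Sum>c\<in>I. w c x * cnj (w c y))"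
  shows "psd_form A K"
  unfolding psd_form_def
proof
  fix v :: "'a \<Rightarrow> complex"
  have "0 \<le> (\<Sum>c\<in>I. cnj (\<Sum>x\<in>A. cnj (w c x) * v x) * (\<Sum>y\<in>A. cnj (w c y) * v y))"
    by (intro sum_nonneg cnj_mult_self_nonneg)
  then show "0 \<le> (\<Sum>x\<in>A. \<Sum>y\<in>A. cnj (v x) * K x y * v y)"
    using gram_form_eq[where A = A and K = K and w = w and I = I, OF assms] by simp
qed

lemma psd_form_imp_gram:
  assumes "finite A" "psd_form A K"
  shows "\<exists>(r::nat) w. \<forall>x\<in>A. \<forall>y\<in>A. K x y = (\<Sum>c<r. w c x * cnj (w c y))"
  using psd_form_rank_factorization[OF assms] by blast

text \<open>Gram vectors are composed with \<open>f\<close>, which may identify indices.\<close>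

lemma psd_form_pullback:
  assumes "finite B" "psd_form B K" "\<And>x. x \<in> A \<Longrightarrow> f x \<in> B"
  shows "psd_form A (\<lambda>x y. K (f x) (f y))"
proof -
  obtain r :: nat and w where w: "\<forall>x\<in>B. \<forall>y\<in>B. K x y = (\<Sum>c<r. w c x * cnj (w c y))"
    using psd_form_imp_gram[OF assms(1,2)] by blast
  show ?thesis
    by (rule psd_form_gram[where w = "\<lambda>c x. w c (f x)" and I = "{..<r}"]) (use w assms(3) in auto)
qed

lemma psd_form_sum:
  assumes "\<And>i. i \<in> I \<Longrightarrow> psd_form A (K i)"
  shows "psd_form A (\<lambda>x y. \<Sum>i\<in>I. K i x y)"
  unfolding psd_form_def
proof
  fix v :: "'b \<Rightarrow> complex"
  have "(\<Sum>x\<in>A. \<Sum>y\<in>A. cnj (v x) * (\<Sum>i\<in>I. K i x y) * v y)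
      = (\<Sum>x\<in>A. \<Sum>y\<in>A. \<Sum>i\<in>I. cnj (v x) * K i x y * v y)"
    by (simp add: sum_distrib_left sum_distrib_right)
  also have "\<dots> = (\<Sum>x\<in>A. \<Sum>i\<in>I. \<Sum>y\<in>A. cnj (v x) * K i x y * v y)"
    by (intro sum.cong refl sum.swap)
  also have "\<dots> = (\<Sum>i\<in>I. \<Sum>x\<in>A. \<Sum>y\<in>A. cnj (v x) * K i x y * v y)"
    by (rule sum.swap)
  finally show "0 \<le> (\<Sum>x\<in>A. \<Sum>y\<in>A. cnj (v x) * (\<Sum>i\<in>I. K i x y) * v y)"
    using assms by (simp add: psd_formD sum_nonneg)
qed

lemma psd_form_add:
  assumes "psd_form A K" "psd_form A L"
  shows "psd_form A (\<lambda>x y. K x y + L x y)"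
  using psd_form_sum[of UNIV A "\<lambda>b. if b then K else L"] assms by (simp add: UNIV_bool add.commute)

text \<open>A vanishing form is a vanishing sum of squares of Gram components, so \<open>u\<close>
  is orthogonal to every Gram vector and the kernel annihilates it. The vector lives on
  \<open>B\<close> and enters through \<open>f\<close>, yet the conclusion holds for every row
  \<open>a\<close> of \<open>A\<close>.\<close>

lemma psd_form_null_vector:
  assumes "finite A" "psd_form A K" "\<And>x. x \<in> B \<Longrightarrow> f x \<in> A"
    and "(\<Sum>x\<in>B. \<Sum>y\<in>B. cnj (u x) * K (f x) (f y) * u y) = 0" "a \<in> A"
  shows "(\<Sum>y\<in>B. K a (f y) * u y) = 0"
proof -
  obtain r :: nat and w where w: "\<forall>x\<in>A. \<forall>y\<in>A. K x y = (\<Sum>c<r. w c x * cnj (w c y))"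
    using psd_form_imp_gram[OF assms(1,2)] by blast
  define z where "z c = (\<Sum>y\<in>B. cnj (w c (f y)) * u y)" for c
  have wf: "K (f x) (f y) = (\<Sum>c<r. w c (f x) * cnj (w c (f y)))" if "x \<in> B" "y \<in> B" for x y
    using w assms(3) that by blast
  have "(\<Sum>c<r. cnj (z c) * z c) = 0"
    using assms(4) gram_form_eq[where A = B and K = "\<lambda>x y. K (f x) (f y)" and I = "{..<r}"
        and w = "\<lambda>c x. w c (f x)" and v = u, OF wf]
    unfolding z_def by simp
  then have z: "z c = 0" if "c < r" for c
    using that by (subst (asm) sum_nonneg_eq_0_iff) (auto intro: cnj_mult_self_nonneg)
  have "(\<Sum>y\<in>B. K a (f y) * u y) = (\<Sum>y\<in>B. \<Sum>c<r. w c a * (cnj (w c (f y)) * u y))"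
    using assms(3,5) by (simp add: w sum_distrib_right mult.assoc)
  also have "\<dots> = (\<Sum>c<r. w c a * z c)"
    unfolding z_def by (subst sum.swap) (simp add: sum_distrib_left)
  finally show ?thesis by (simp add: z)
qed

text \<open>Conjugation by 1 \<otimes> \<open>v\<close>: the matrix \<open>v\<close> acts on the
  second leg of each Gram vector.\<close>

lemma psd_form_congruence:
  assumes "finite B" "finite X" "psd_form (B \<times> X) K"
  shows "psd_form (B \<times> Q) (\<lambda>(b, q) (b', q'). \<Sum>x\<in>X. \<Sum>x'\<in>X. v q x * K (b, x) (b', x') * cnj (v q' x'))"
proof -
  obtain r :: nat and w where w: "\<forall>x\<in>B \<times> X. \<forall>y\<in>B \<times> X. K x y = (\<Sum>c<r. w c x * cnj (w c y))"
    using psd_form_imp_gram[OF finite_cartesian_product[OF assms(1,2)] assms(3)] by blast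
  have "(\<Sum>x\<in>X. \<Sum>x'\<in>X. v q x * K (b, x) (b', x') * cnj (v q' x'))
      = (\<Sum>c<r. (\<Sum>x\<in>X. v q x * w c (b, x)) * cnj (\<Sum>x\<in>X. v q' x * w c (b', x)))"
    if "b \<in> B" "b' \<in> B" for b q b' q'
  proof -
    have "(\<Sum>x\<in>X. \<Sum>x'\<in>X. v q x * K (b, x) (b', x') * cnj (v q' x'))
      = (\<Sum>x\<in>X. \<Sum>x'\<in>X. \<Sum>c<r. (v q x * w c (b, x)) * cnj (v q' x' * w c (b', x')))"
      using that by (intro sum.cong refl) (simp add: w sum_distrib_left sum_distrib_right mult_ac)
    also have "\<dots> = (\<Sum>x\<in>X. \<Sum>c<r. \<Sum>x'\<in>X. (v q x * w c (b, x)) * cnj (v q' x' * w c (b', x')))"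
      by (intro sum.cong refl sum.swap)
    also have "\<dots> = (\<Sum>c<r. \<Sum>x\<in>X. \<Sum>x'\<in>X. (v q x * w c (b, x)) * cnj (v q' x' * w c (b', x')))"
      by (rule sum.swap)
    finally show ?thesis by (simp add: sum_product)
  qed
  then show ?thesis
    by (intro psd_form_gram[where I = "{..<r}" and w = "\<lambda>c (b, q). \<Sum>x\<in>X. v q x * w c (b, x)"])
      clarsimp
qed

text \<open>A coordinate projection. It supplies the constant channel that normalises the marginal
  and the pure state that completes the decoder.\<close>

lemma psd_form_diagonal:
  assumes "finite A"
  shows "psd_form A (\<lambda>x y. if x = y \<and> P x then 1 else 0)"
  unfolding psd_form_def
proof
  fix v :: "'a \<Rightarrow> complex"
  have "(\<Sum>y\<in>A. cnj (v x) * (if x = y \<and> P x then 1 else 0) * v y) = (if P x then cnj (v x) * v x else 0)"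
    if "x \<in> A" for x
    using that assms by (cases "P x") (simp_all add: if_distrib if_distribR cong: if_cong)
  then have "(\<Sum>x\<in>A. \<Sum>y\<in>A. cnj (v x) * (if x = y \<and> P x then 1 else 0) * v y)
      = (\<Sum>x\<in>A. if P x then cnj (v x) * v x else 0)"
    by (rule sum.cong[OF refl])
  moreover have "0 \<le> (\<Sum>x\<in>A. if P x then cnj (v x) * v x else 0)"
    by (rule sum_nonneg) (simp only: cnj_mult_self_nonneg order_refl split: if_split, simp)
  ultimately show "0 \<le> (\<Sum>x\<in>A. \<Sum>y\<in>A. cnj (v x) * (if x = y \<and> P x then 1 else 0) * v y)"
    by simp
qed

section \<open>Index arithmetic for tensor products\<close>

lemma mult_add_less_mult:
  assumes "a < (n::nat)" "p < m"
  shows "a * m + p < n * m"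
proof -
  have "a * m + p < Suc a * m" using assms by simp
  also have "\<dots> \<le> n * m" using assms by (intro mult_le_mono1) simp
  finally show ?thesis .
qed

lemma sum_lessThan_mult:
  "(\<Sum>x<n * (m::nat). f x) = (\<Sum>a<n. \<Sum>p<m. f (a * m + p) :: 'a::comm_monoid_add)"
proof -
  have "(\<Sum>x<n * m. f x) = (\<Sum>a<n. sum f {a * m..<a * m + m})"
    by (rule sum.nat_group[symmetric])
  also have "\<dots> = (\<Sum>a<n. \<Sum>p<m. f (a * m + p))"
    using sum.shift_bounds_nat_ivl[of f 0 "_ * m" m] by (simp add: add.commute lessThan_atLeast0)
  finally show ?thesis .
qed

section \<open>Linear maps given by their Choi kernels\<close>

text \<open>\<open>g j i\<close> is the block \<open>J(F)\<^sub>j\<^sub>i\<close> of the Choi operator, as a kernel on pairs (output index, input index).\<close>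
definition kmap :: "('i::finite \<Rightarrow> nat) \<Rightarrow> ('j \<Rightarrow> nat) \<Rightarrow>
    ('j \<Rightarrow> 'i \<Rightarrow> nat \<times> nat \<Rightarrow> nat \<times> nat \<Rightarrow> complex) \<Rightarrow> ('i \<Rightarrow> complex mat) \<Rightarrow> ('j \<Rightarrow> complex mat)" where
  "kmap d d' g X = (\<lambda>j. mat (d' j) (d' j)
     (\<lambda>(r, s). \<Sum>i\<in>UNIV. \<Sum>a<d i. \<Sum>b<d i. X i $$ (a, b) * g j i (r, a) (s, b)))"

lemma kmap_carrier [simp]: "kmap d d' g X j \<in> carrier_mat (d' j) (d' j)"
  by (simp add: kmap_def)

lemma kmap_index:
  "r < d' j \<Longrightarrow> s < d' j \<Longrightarrow>
    kmap d d' g X j $$ (r, s) = (\<Sum>i\<in>UNIV. \<Sum>a<d i. \<Sum>b<d i. X i $$ (a, b) * g j i (r, a) (s, b))"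
  by (simp add: kmap_def)

lemma elemD: "elem d X \<Longrightarrow> X i \<in> carrier_mat (d i) (d i)"
  by (simp add: elem_def)

lemma lin_map_kmap: "lin_map d d' (kmap d d' g)"
  unfolding lin_map_def
proof (intro conjI allI impI)
  fix X assume X: "elem d X"
  show "elem d' (kmap d d' g X)" by (simp add: elem_def)
  fix Y assume Y: "elem d Y"
  show "kmap d d' g (\<lambda>i. X i + Y i) = (\<lambda>j. kmap d d' g X j + kmap d d' g Y j)"
  proof (intro ext eq_matI)
    fix j r s assume "r < dim_row (kmap d d' g X j + kmap d d' g Y j)"
      "s < dim_col (kmap d d' g X j + kmap d d' g Y j)"
    then have rs: "r < d' j" "s < d' j" by (auto simp: kmap_def)
    have "(X i + Y i) $$ (a, b) = X i $$ (a, b) + Y i $$ (a, b)" if "a < d i" "b < d i" for i a b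
      using that elemD[OF Y, of i] by auto
    then show "kmap d d' g (\<lambda>i. X i + Y i) j $$ (r, s) = (kmap d d' g X j + kmap d d' g Y j) $$ (r, s)"
      using rs by (simp add: kmap_def sum.distrib distrib_right)
  qed (auto simp: kmap_def)
next
  fix c X assume X: "elem d X"
  show "kmap d d' g (\<lambda>i. c \<cdot>\<^sub>m X i) = (\<lambda>j. c \<cdot>\<^sub>m kmap d d' g X j)"
  proof (intro ext eq_matI)
    fix j r s assume "r < dim_row (c \<cdot>\<^sub>m kmap d d' g X j)" "s < dim_col (c \<cdot>\<^sub>m kmap d d' g X j)"
    then have rs: "r < d' j" "s < d' j" by (auto simp: kmap_def)
    have "(c \<cdot>\<^sub>m X i) $$ (a, b) = c * X i $$ (a, b)" if "a < d i" "b < d i" for i a b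
      using that elemD[OF X, of i] by auto
    then show "kmap d d' g (\<lambda>i. c \<cdot>\<^sub>m X i) j $$ (r, s) = (c \<cdot>\<^sub>m kmap d d' g X j) $$ (r, s)"
      using rs by (simp add: kmap_def sum_distrib_left mult.assoc)
  qed (auto simp: kmap_def)
qed

text \<open>The bridge from the flattened indices of the matrix definitions to pairs. Both
  directions are pullbacks, along \<open>a * m + p\<close> and along its inverse by
  \<open>div\<close> and \<open>mod\<close>.\<close>

lemma psd_form_div_mod_iff:
  fixes n m :: nat
  assumes "m > 0"
  shows "psd_form {..<n * m} (\<lambda>x y. K (x div m, x mod m) (y div m, y mod m)) \<longleftrightarrow>
    psd_form ({..<n} \<times> {..<m}) K" (is "?L \<longleftrightarrow> ?R")
proof
  assume ?L
  then have "psd_form ({..<n} \<times> {..<m}) (\<lambda>x y. K ((fst x * m + snd x) div m, (fst x * m + snd x) mod m)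
     ((fst y * m + snd y) div m, (fst y * m + snd y) mod m))"
    by (rule psd_form_pullback[OF finite_lessThan]) (auto simp: mult_add_less_mult)
  moreover have "((fst x * m + snd x) div m, (fst x * m + snd x) mod m) = x" if "x \<in> {..<n} \<times> {..<m}" for x
    using that by auto
  ultimately show ?R
    by (subst (asm) psd_form_cong[where L = K]) simp_all
next
  assume ?R
  then show ?L
    by (rule psd_form_pullback[rotated]) (use assms in \<open>auto simp: less_mult_imp_div_less\<close>)
qed

text \<open>The link product over \<open>B\<close>. Contracting a Gram vector of \<open>X\<close>
  with one of \<open>g\<close> over the common index gives Gram vectors indexed by pairs.\<close>

lemma psd_form_contract:
  assumes "finite B" "psd_form (B \<times> D) X" "finite D" "finite A" "psd_form (A \<times> B) g"
  shows "psd_form (A \<times> D) (\<lambda>(r, p) (s, q). \<Sum>a\<in>B. \<Sum>b\<in>B. X (a, p) (b, q) * g (r, a) (s, b))"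
proof -
  obtain R1 :: nat and w where w: "\<forall>x\<in>B \<times> D. \<forall>y\<in>B \<times> D. X x y = (\<Sum>c<R1. w c x * cnj (w c y))"
    using psd_form_imp_gram[OF finite_cartesian_product[OF assms(1,3)] assms(2)] by blast
  obtain R2 :: nat and z where z: "\<forall>x\<in>A \<times> B. \<forall>y\<in>A \<times> B. g x y = (\<Sum>c<R2. z c x * cnj (z c y))"
    using psd_form_imp_gram[OF finite_cartesian_product[OF assms(4,1)] assms(5)] by blast
  show ?thesis
  proof (rule psd_form_gram[where I = "{..<R1} \<times> {..<R2}"
        and w = "\<lambda>(c, e) (r, p). \<Sum>a\<in>B. w c (a, p) * z e (r, a)"], clarify)
    fix r p s q assume "r \<in> A" "p \<in> D" "s \<in> A" "q \<in> D"
    then have "(\<Sum>a\<in>B. \<Sum>b\<in>B. X (a, p) (b, q) * g (r, a) (s, b))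
      = (\<Sum>a\<in>B. \<Sum>b\<in>B. (\<Sum>(c, e)\<in>{..<R1} \<times> {..<R2}. (w c (a, p) * z e (r, a)) * cnj (w c (b, q) * z e (s, b))))"
      by (intro sum.cong refl) (simp add: w z sum_product sum.cartesian_product mult_ac)
    also have "\<dots> = (\<Sum>a\<in>B. (\<Sum>(c, e)\<in>{..<R1} \<times> {..<R2}. \<Sum>b\<in>B. (w c (a, p) * z e (r, a)) * cnj (w c (b, q) * z e (s, b))))"
      unfolding case_prod_unfold by (intro sum.cong refl sum.swap)
    also have "\<dots> = (\<Sum>(c, e)\<in>{..<R1} \<times> {..<R2}. \<Sum>a\<in>B. \<Sum>b\<in>B. (w c (a, p) * z e (r, a)) * cnj (w c (b, q) * z e (s, b)))"
      unfolding case_prod_unfold by (rule sum.swap)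
    also have "\<dots> = (\<Sum>ce\<in>{..<R1} \<times> {..<R2}. (case ce of (c, e) \<Rightarrow> \<lambda>(r, p). \<Sum>a\<in>B. w c (a, p) * z e (r, a)) (r, p)
        * cnj ((case ce of (c, e) \<Rightarrow> \<lambda>(r, p). \<Sum>a\<in>B. w c (a, p) * z e (r, a)) (s, q)))"
      by (simp add: sum_product case_prod_unfold)
    finally show "(\<Sum>a\<in>B. \<Sum>b\<in>B. X (a, p) (b, q) * g (r, a) (s, b))
      = (\<Sum>ce\<in>{..<R1} \<times> {..<R2}. (case ce of (c, e) \<Rightarrow> \<lambda>(r, p). \<Sum>a\<in>B. w c (a, p) * z e (r, a)) (r, p)
        * cnj ((case ce of (c, e) \<Rightarrow> \<lambda>(r, p). \<Sum>a\<in>B. w c (a, p) * z e (r, a)) (s, q)))" .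
  qed
qed

text \<open>The easy half of Choi's theorem: each output block of F \<otimes> id is a sum over
  \<open>i\<close> of link products of the argument with Choi blocks. Both channels of the comb get
  complete positivity from it.\<close>

lemma comp_pos_kmap:
  assumes "\<And>j i. psd_form ({..<d' j} \<times> {..<d i}) (g j i)"
  shows "comp_pos d d' (kmap d d' g)"
  unfolding comp_pos_def
proof (intro allI impI)
  fix m :: nat and X assume m: "m > 0" and X: "elem_pos (\<lambda>i. d i * m) X"
  let ?Y = "tensor_id d d' m (kmap d d' g) X"
  define x where "x i = (\<lambda>(a, p) (b, q). X i $$ (a * m + p, b * m + q))" for i
  have x: "psd_form ({..<d i} \<times> {..<m}) (x i)" for i
    using X unfolding psd_form_div_mod_iff[OF m, symmetric] x_def
    by (auto simp: elem_pos_def psd_iff_psd_form)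
  define y where "y j = (\<lambda>(r, p) (s, q). \<Sum>i\<in>UNIV. \<Sum>a<d i. \<Sum>b<d i. x i (a, p) (b, q) * g j i (r, a) (s, b))" for j
  have "psd_form ({..<d' j} \<times> {..<m}) (y j)" for j
    using psd_form_sum[of UNIV "{..<d' j} \<times> {..<m}" "\<lambda>i (r, p) (s, q). \<Sum>a<d i. \<Sum>b<d i. x i (a, p) (b, q) * g j i (r, a) (s, b)"]
      psd_form_contract[OF _ x _ _ assms] by (simp add: y_def case_prod_unfold)
  then have y: "psd_form {..<d' j * m} (\<lambda>r s. y j (r div m, r mod m) (s div m, s mod m))" for j
    by (simp only: psd_form_div_mod_iff[OF m])
  have yY: "?Y j $$ (r, s) = y j (r div m, r mod m) (s div m, s mod m)" if "r < d' j * m" "s < d' j * m" for j r s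
    using that by (simp add: tensor_id_def kmap_def y_def x_def subblock_def less_mult_imp_div_less)
  have "psd (d' j * m) (?Y j)" for j
    unfolding psd_iff_psd_form
  proof
    show "?Y j \<in> carrier_mat (d' j * m) (d' j * m)" by (simp add: tensor_id_def)
    show "psd_form {..<d' j * m} (\<lambda>a b. ?Y j $$ (a, b))"
      using y[of j] by (subst psd_form_cong[OF yY]) auto
  qed
  then show "elem_pos (\<lambda>j. d' j * m) ?Y"
    by (auto simp: elem_pos_def elem_def psd_def)
qed

lemma trace_pres_kmap:
  fixes d :: "'i::finite \<Rightarrow> nat" and d' :: "'j::finite \<Rightarrow> nat"
  assumes "\<And>i a b. a < d i \<Longrightarrow> b < d i \<Longrightarrow>
    (\<Sum>j\<in>UNIV. \<Sum>r<d' j. g j i (r, a) (r, b)) = (if a = b then 1 else 0)"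
  shows "trace_pres d d' (kmap d d' g)"
  unfolding trace_pres_def
proof (intro allI impI)
  fix X :: "'i \<Rightarrow> complex mat"
  have Pi: "(\<Sum>i\<in>UNIV. \<Sum>a<d i. \<Sum>b<d i. f i a b)
      = (\<Sum>(i, a, b)\<in>Sigma UNIV (\<lambda>i. {..<d i} \<times> {..<d i}). f i a b)" for f :: "'i \<Rightarrow> nat \<Rightarrow> nat \<Rightarrow> complex"
    by (simp add: sum.Sigma sum.cartesian_product)
  have Pj: "(\<Sum>j\<in>UNIV. \<Sum>r<d' j. f j r) = (\<Sum>(j, r)\<in>Sigma UNIV (\<lambda>j. {..<d' j}). f j r)"
    for f :: "'j \<Rightarrow> nat \<Rightarrow> complex"
    by (simp add: sum.Sigma)
  have "tr_elem d' (kmap d d' g X)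
      = (\<Sum>j\<in>UNIV. \<Sum>r<d' j. \<Sum>i\<in>UNIV. \<Sum>a<d i. \<Sum>b<d i. X i $$ (a, b) * g j i (r, a) (r, b))"
    by (simp add: tr_elem_def kmap_def)
  also have "\<dots> = (\<Sum>i\<in>UNIV. \<Sum>a<d i. \<Sum>b<d i. \<Sum>j\<in>UNIV. \<Sum>r<d' j. X i $$ (a, b) * g j i (r, a) (r, b))"
    unfolding Pi Pj case_prod_unfold by (rule sum.swap)
  also have "\<dots> = (\<Sum>i\<in>UNIV. \<Sum>a<d i. \<Sum>b<d i. X i $$ (a, b) * (\<Sum>j\<in>UNIV. \<Sum>r<d' j. g j i (r, a) (r, b)))"
    by (simp add: sum_distrib_left)
  also have "\<dots> = tr_elem d X"
    by (simp add: assms tr_elem_def if_distrib if_distribR cong: if_cong)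
  finally show "tr_elem d' (kmap d d' g X) = tr_elem d X" .
qed

section \<open>Matrix-unit expansions and Choi blocks of given maps\<close>

lemma elem_munit: "elem d (munit d i a b)"
  by (simp add: elem_def munit_def)

lemma lin_map_carrier: "lin_map d d' F \<Longrightarrow> elem d X \<Longrightarrow> F X j \<in> carrier_mat (d' j) (d' j)"
  by (simp add: lin_map_def elem_def)

text \<open>Additivity in \<open>lin_map\<close> is for two summands, so the expansion in matrix
  units is an induction over the finite set of retained entries, with \<open>Y P\<close> the
  truncation of \<open>X\<close> to \<open>P\<close>.\<close>

lemma lin_map_index_expand:
  fixes d :: "'i::finite \<Rightarrow> nat"
  assumes F: "lin_map d d' F" and X: "elem d X" and rs: "r < d' j" "s < d' j"
  shows "F X j $$ (r, s) = (\<Sum>i\<in>UNIV. \<Sum>a<d i. \<Sum>b<d i. X i $$ (a, b) * F (munit d i a b) j $$ (r, s))"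
proof -
  define Y where "Y P i = mat (d i) (d i) (\<lambda>(a, b). if (i, a, b) \<in> P then X i $$ (a, b) else 0)" for P i
  have Y: "elem d (Y P)" for P by (simp add: elem_def Y_def)
  let ?T = "Sigma UNIV (\<lambda>i. {..<d i} \<times> {..<d i})"
  have "F (Y P) j $$ (r, s) = (\<Sum>(i, a, b)\<in>P. X i $$ (a, b) * F (munit d i a b) j $$ (r, s))"
    if "finite P" "P \<subseteq> ?T" for P
    using that
  proof (induction P rule: finite_induct)
    case empty
    \<comment> \<open>The value at the zero element comes from homogeneity with scalar 0.\<close>
    have "F (\<lambda>i. 0 \<cdot>\<^sub>m Y {} i) = (\<lambda>j. 0 \<cdot>\<^sub>m F (Y {}) j)"
      using F Y by (simp add: lin_map_def)
    moreover have "(\<lambda>i. 0 \<cdot>\<^sub>m Y {} i) = Y {}"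
      by (intro ext eq_matI) (auto simp: Y_def)
    ultimately have "F (Y {}) j $$ (r, s) = (0 \<cdot>\<^sub>m F (Y {}) j) $$ (r, s)" by metis
    then show ?case using rs lin_map_carrier[OF F Y, of "{}" j] by simp
  next
    case (insert t P)
    obtain i a b where t: "t = (i, a, b)" by (cases t)
    then have ab: "a < d i" "b < d i" using insert.prems by auto
    let ?c = "X i $$ (a, b)"
    have E: "elem d (\<lambda>i'. ?c \<cdot>\<^sub>m munit d i a b i')" by (simp add: elem_def munit_def)
    have "Y (insert t P) = (\<lambda>i'. Y P i' + ?c \<cdot>\<^sub>m munit d i a b i')"
      by (intro ext eq_matI) (use insert.hyps in \<open>auto simp: Y_def munit_def t\<close>)
    then have "F (Y (insert t P)) = (\<lambda>j. F (Y P) j + F (\<lambda>i'. ?c \<cdot>\<^sub>m munit d i a b i') j)"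
      using F Y E by (simp add: lin_map_def)
    also have "F (\<lambda>i'. ?c \<cdot>\<^sub>m munit d i a b i') = (\<lambda>j. ?c \<cdot>\<^sub>m F (munit d i a b) j)"
      using F elem_munit[of d i a b] by (simp add: lin_map_def)
    finally show ?case
      using insert rs lin_map_carrier[OF F Y, of P j] lin_map_carrier[OF F elem_munit, of i a b j]
      by (simp add: t)
  qed
  note expand = this
  have "Y ?T = X"
  proof (intro ext eq_matI)
    fix i a b assume "a < dim_row (X i)" "b < dim_col (X i)"
    then show "Y ?T i $$ (a, b) = X i $$ (a, b)" using elemD[OF X, of i] by (simp add: Y_def)
  next
    fix i show "dim_row (Y ?T i) = dim_row (X i)" "dim_col (Y ?T i) = dim_col (X i)"
      using elemD[OF X, of i] by (auto simp: Y_def)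
  qed
  then have "F X j $$ (r, s) = (\<Sum>(i, a, b)\<in>?T. X i $$ (a, b) * F (munit d i a b) j $$ (r, s))"
    using expand[of ?T] by simp
  then show ?thesis
    by (simp add: sum.Sigma sum.cartesian_product)
qed

text \<open>The other half of Choi's theorem: the ancilla gets the dimension of block
  \<open>i\<close>, and the extended map is applied to the maximally entangled vector of that
  block.\<close>

lemma comp_pos_choi_psd:
  assumes F: "comp_pos d d' F" and i: "d i > 0"
  shows "psd_form ({..<d' j} \<times> {..<d i}) (\<lambda>(r, a) (s, b). F (munit d i a b) j $$ (r, s))"
proof -
  let ?m = "d i"
  \<comment> \<open>In flattened indices, \<open>w\<close> is the unnormalised vector with
    coordinate 1 at each pair (a, a). Hence subblock (p, q) of the rank-one block \<open>X i\<close>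
    is the matrix unit at (p, q).\<close>
  define w :: "nat \<Rightarrow> complex" where "w x = (if x div ?m = x mod ?m then 1 else 0)" for x
  define X where "X i' = (if i' = i then mat (?m * ?m) (?m * ?m) (\<lambda>(x, y). w x * w y)
    else 0\<^sub>m (d i' * ?m) (d i' * ?m))" for i'
  have "psd_form {..<d i' * ?m} (\<lambda>x y. X i' $$ (x, y))" for i'
    by (rule psd_form_gram[where I = "if i' = i then {()} else {}" and w = "\<lambda>_. w"])
      (auto simp: X_def w_def)
  then have "elem_pos (\<lambda>i. d i * ?m) X"
    by (auto simp: elem_pos_def elem_def psd_iff_psd_form X_def)
  then have "psd (d' j * ?m) (tensor_id d d' ?m F X j)"
    using F i by (simp add: comp_pos_def elem_pos_def)
  then have "psd_form {..<d' j * ?m} (\<lambda>x y. tensor_id d d' ?m F X j $$ (x, y))"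
    by (simp add: psd_iff_psd_form)
  moreover have "(\<lambda>i'. subblock (d i') ?m p q (X i')) = munit d i p q" if "p < ?m" "q < ?m" for p q
  proof (intro ext eq_matI)
    fix i' x y assume "x < dim_row (munit d i p q i')" "y < dim_col (munit d i p q i')"
    then have "x < d i'" "y < d i'" by (auto simp: munit_def split: if_splits)
    then show "subblock (d i') ?m p q (X i') $$ (x, y) = munit d i p q i' $$ (x, y)"
      using that by (auto simp: subblock_def X_def munit_def w_def mult_add_less_mult)
  qed (auto simp: subblock_def munit_def)
  then have "tensor_id d d' ?m F X j $$ (x, y) =
      (\<lambda>(r, a) (s, b). F (munit d i a b) j $$ (r, s)) (x div ?m, x mod ?m) (y div ?m, y mod ?m)"
    if "x \<in> {..<d' j * ?m}" "y \<in> {..<d' j * ?m}" for x y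
    using that i by (simp add: tensor_id_def)
  ultimately have "psd_form {..<d' j * ?m} (\<lambda>x y. (\<lambda>(r, a) (s, b). F (munit d i a b) j $$ (r, s))
      (x div ?m, x mod ?m) (y div ?m, y mod ?m))"
    by (simp only: cong: psd_form_cong)
  then show ?thesis
    by (rule psd_form_div_mod_iff[OF i, THEN iffD1])
qed

text \<open>A crude norm bound: the form of \<open>H\<close> at \<open>v\<close> is real by
  Hermitian symmetry, and its modulus is at most the sum of the moduli of the entries of
  \<open>H\<close> times the squared norm of \<open>v\<close>.\<close>

lemma psd_form_perturbed_identity:
  fixes H :: "'x \<Rightarrow> 'x \<Rightarrow> complex"
  assumes A: "finite A" and herm: "\<And>x y. x \<in> A \<Longrightarrow> y \<in> A \<Longrightarrow> H y x = cnj (H x y)"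
    and e: "0 \<le> e" and q: "e * (\<Sum>x\<in>A. \<Sum>y\<in>A. cmod (H x y)) \<le> q"
  shows "psd_form A (\<lambda>x y. (if x = y then of_real q else 0) + of_real e * H x y)"
  unfolding psd_form_def
proof
  fix v :: "'x \<Rightarrow> complex"
  define S where "S = (\<Sum>x\<in>A. (cmod (v x))\<^sup>2)"
  define h where "h = (\<Sum>x\<in>A. \<Sum>y\<in>A. cnj (v x) * H x y * v y)"
  have "cnj h = (\<Sum>x\<in>A. \<Sum>y\<in>A. cnj (v y) * H y x * v x)"
    unfolding h_def cnj_sum
  proof (intro sum.cong refl)
    fix x y assume "x \<in> A" "y \<in> A"
    then show "cnj (cnj (v x) * H x y * v y) = cnj (v y) * H y x * v x"
      using herm[of x y] by simp
  qed
  also have "\<dots> = h" unfolding h_def by (rule sum.swap)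
  finally have im: "Im h = 0" by (simp add: complex_eq_iff)
  have le: "(cmod (v x))\<^sup>2 \<le> S" if "x \<in> A" for x
    unfolding S_def using that A by (intro member_le_sum) auto
  have le2: "cmod (v x) * cmod (v y) \<le> S" if "x \<in> A" "y \<in> A" for x y
  proof -
    have "2 * (cmod (v x) * cmod (v y)) \<le> (cmod (v x))\<^sup>2 + (cmod (v y))\<^sup>2"
      using sum_squares_bound[of "cmod (v x)" "cmod (v y)"] by simp
    then show ?thesis using le[OF that(1)] le[OF that(2)] by simp
  qed
  have "cmod h \<le> (\<Sum>x\<in>A. \<Sum>y\<in>A. cmod (H x y) * S)"
    unfolding h_def
  proof (intro sum_norm_le)
    fix x y assume xy: "x \<in> A" "y \<in> A"
    have "norm (cnj (v x) * H x y * v y) = cmod (H x y) * (cmod (v x) * cmod (v y))"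
      by (simp add: norm_mult)
    also have "\<dots> \<le> cmod (H x y) * S" by (intro mult_left_mono le2 xy) simp
    finally show "norm (cnj (v x) * H x y * v y) \<le> cmod (H x y) * S" .
  qed
  then have "e * cmod h \<le> e * ((\<Sum>x\<in>A. \<Sum>y\<in>A. cmod (H x y)) * S)"
    using e by (intro mult_left_mono) (simp_all add: sum_distrib_right)
  also have "\<dots> \<le> q * S"
    using mult_right_mono[OF q, of S] by (simp add: S_def sum_nonneg mult.assoc)
  finally have "0 \<le> q * S + e * Re h"
    using mult_left_mono[OF abs_Re_le_cmod[of h] e] abs_le_iff[of "Re h" "\<bar>Re h\<bar>"] e
    by (smt (verit) mult_left_mono mult_minus_right)
  then have "0 \<le> of_real q * of_real S + of_real e * h"
    using im by (simp add: less_eq_complex_def)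
  also have "of_real q * of_real S = (\<Sum>x\<in>A. \<Sum>y\<in>A. cnj (v x) * (if x = y then of_real q else 0) * v y)"
    using A by (simp add: S_def if_distrib if_distribR sum_distrib_left complex_norm_square mult_ac
        cong: if_cong del: of_real_power)
  also have "\<dots> + of_real e * h
      = (\<Sum>x\<in>A. \<Sum>y\<in>A. cnj (v x) * ((if x = y then of_real q else 0) + of_real e * H x y) * v y)"
    by (simp add: h_def sum_distrib_left sum.distrib[symmetric] algebra_simps)
  finally show "0 \<le> (\<Sum>x\<in>A. \<Sum>y\<in>A. cnj (v x) * ((if x = y then of_real q else 0) + of_real e * H x y) * v y)" .
qed

lemma sum_eq_single:
  assumes "finite A" "a \<in> A" "\<And>x. x \<in> A \<Longrightarrow> x \<noteq> a \<Longrightarrow> f x = 0"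
  shows "sum f A = f a"
  using assms sum.mono_neutral_left[of A "{a}" f] by auto

section \<open>Functionals that are constant on channels\<close>

text \<open>The maximally mixed channel is an interior point, so it may be perturbed by a small multiple of \<open>H\<close>.\<close>
lemma hom_functional_vanishes_hermitian:
  fixes dA :: "'i::finite \<Rightarrow> nat" and dB :: "'j::finite \<Rightarrow> nat"
    and t :: "'j \<Rightarrow> 'i \<Rightarrow> nat \<times> nat \<Rightarrow> nat \<times> nat \<Rightarrow> complex"
  defines "D \<equiv> \<lambda>j i. {..<dB j} \<times> {..<dA i}"
  defines "pair \<equiv> \<lambda>H. \<Sum>j\<in>UNIV. \<Sum>i\<in>UNIV. \<Sum>x\<in>D j i. \<Sum>y\<in>D j i. H j i x y * t j i x y"
  assumes dB: "\<And>j. dB j > 0"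
    and t: "\<And>H. (\<And>j i. psd_form (D j i) (H j i)) \<Longrightarrow>
        (\<And>i a a'. a < dA i \<Longrightarrow> a' < dA i \<Longrightarrow>
          (\<Sum>j\<in>UNIV. \<Sum>b<dB j. H j i (b, a) (b, a')) = (if a = a' then 1 else 0)) \<Longrightarrow> pair H = c"
    and herm: "\<And>j i x y. H j i y x = cnj (H j i x y)"
    and marg: "\<And>i a a'. a < dA i \<Longrightarrow> a' < dA i \<Longrightarrow> (\<Sum>j\<in>UNIV. \<Sum>b<dB j. H j i (b, a) (b, a')) = 0"
  shows "pair H = 0"
proof -
  \<comment> \<open>\<open>N\<close> is the total output dimension, so the identity divided by
    \<open>N\<close> in every block satisfies (TP): it is the Choi operator of the completely
    depolarizing channel.\<close>
  define N where "N = (\<Sum>j\<in>UNIV. real (dB j))"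
  have N: "N > 0" unfolding N_def by (rule sum_pos) (use dB in auto)
  define n where "n j i = (\<Sum>x\<in>D j i. \<Sum>y\<in>D j i. cmod (H j i x y))" for j i
  \<comment> \<open>The summand 1 keeps \<open>C\<close> positive even if \<open>H\<close> is 0, so
    that the step 1 / (N C) is positive.\<close>
  define C where "C = 1 + (\<Sum>j\<in>UNIV. \<Sum>i\<in>UNIV. n j i)"
  have n0: "0 \<le> n j i" for j i by (simp add: n_def sum_nonneg)
  have nC: "n j i \<le> C" "C > 0" for j i
  proof -
    have "n j i \<le> (\<Sum>i\<in>UNIV. n j i)" by (rule member_le_sum) (use n0 in auto)
    also have "\<dots> \<le> (\<Sum>j\<in>UNIV. \<Sum>i\<in>UNIV. n j i)"
      using member_le_sum[where f = "\<lambda>j. \<Sum>i\<in>UNIV. n j i" and A = UNIV and i = j] n0 by (simp add: sum_nonneg)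
    finally show "n j i \<le> C" "C > 0" using n0[of j i] by (auto simp: C_def)
  qed
  define U where "U e j i x y = (if x = y then of_real (1 / N) else 0) + of_real e * H j i x y" for e j i x y
  have U: "pair (U e) = c" if e: "0 \<le> e" "e \<le> 1 / (N * C)" for e
  proof (rule t)
    fix j i
    have "e * n j i \<le> 1 / (N * C) * C"
      by (intro mult_mono) (use e n0[of j i] nC(1)[of j i] nC(2) N in auto)
    also have "\<dots> = 1 / N" using nC(2) by simp
    finally show "psd_form (D j i) (U e j i)"
      unfolding U_def n_def
      by (intro psd_form_perturbed_identity herm e) (auto simp: D_def)
  next
    fix i a a' assume a: "a < dA i" "a' < dA i"
    define k where "k = complex_of_real (1 / N)"
    have "of_real N = (\<Sum>j\<in>UNIV. complex_of_nat (dB j))" by (simp add: N_def)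
    moreover have "of_real N * k = 1" using N by (simp add: k_def)
    ultimately have k: "(\<Sum>j\<in>UNIV. complex_of_nat (dB j) * k) = 1"
      by (simp add: sum_distrib_right[symmetric])
    have "(\<Sum>j\<in>UNIV. \<Sum>b<dB j. U e j i (b, a) (b, a'))
      = (\<Sum>j\<in>UNIV. \<Sum>b<dB j. if a = a' then k else 0)
        + of_real e * (\<Sum>j\<in>UNIV. \<Sum>b<dB j. H j i (b, a) (b, a'))"
      by (simp add: U_def k_def sum.distrib sum_distrib_left)
    also have "(\<Sum>j\<in>UNIV. \<Sum>b<dB j. if a = a' then k else 0) = (if a = a' then 1 else 0)"
      by (simp add: k)
    finally show "(\<Sum>j\<in>UNIV. \<Sum>b<dB j. U e j i (b, a) (b, a')) = (if a = a' then 1 else 0)"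
      using N marg[OF a] by simp
  qed
  \<comment> \<open>The pairing is affine along the segment and takes the value \<open>c\<close> at
    both ends, so its slope \<open>pair H\<close> vanishes.\<close>
  have "pair (U e) = pair (U 0) + of_real e * pair H" for e
    by (simp add: pair_def U_def sum.distrib sum_distrib_left algebra_simps)
  moreover have "0 < 1 / (N * C)" using N nC(2) by simp
  ultimately show ?thesis
    using U[of 0] U[of "1 / (N * C)"] by (metis add_cancel_left_right less_eq_real_def mult_eq_0_iff
        of_real_eq_0_iff order_less_irrefl)
qed

text \<open>Reduction to the Hermitian case: H plus its adjoint, and i times the difference of H and
  its adjoint, are Hermitian with zero marginal; 2 H is the first minus i times the second.\<close>

lemma hom_functional_vanishes:
  fixes dA :: "'i::finite \<Rightarrow> nat" and dB :: "'j::finite \<Rightarrow> nat"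
    and t :: "'j \<Rightarrow> 'i \<Rightarrow> nat \<times> nat \<Rightarrow> nat \<times> nat \<Rightarrow> complex"
  defines "D \<equiv> \<lambda>j i. {..<dB j} \<times> {..<dA i}"
  defines "pair \<equiv> \<lambda>H. \<Sum>j\<in>UNIV. \<Sum>i\<in>UNIV. \<Sum>x\<in>D j i. \<Sum>y\<in>D j i. H j i x y * t j i x y"
  assumes dB: "\<And>j. dB j > 0"
    and t: "\<And>H. (\<And>j i. psd_form (D j i) (H j i)) \<Longrightarrow>
        (\<And>i a a'. a < dA i \<Longrightarrow> a' < dA i \<Longrightarrow>
          (\<Sum>j\<in>UNIV. \<Sum>b<dB j. H j i (b, a) (b, a')) = (if a = a' then 1 else 0)) \<Longrightarrow> pair H = c"
    and marg: "\<And>i a a'. a < dA i \<Longrightarrow> a' < dA i \<Longrightarrow> (\<Sum>j\<in>UNIV. \<Sum>b<dB j. H j i (b, a) (b, a')) = 0"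
  shows "pair H = 0"
proof -
  have marg': "(\<Sum>j\<in>UNIV. \<Sum>b<dB j. cnj (H j i (b, a') (b, a))) = 0" if "a < dA i" "a' < dA i" for i a a'
    using arg_cong[OF marg[OF that(2,1)], of cnj] by simp
  have 1: "pair (\<lambda>j i x y. H j i x y + cnj (H j i y x)) = 0"
    unfolding pair_def D_def
    by (rule hom_functional_vanishes_hermitian[OF dB t[unfolded pair_def D_def]])
      (simp_all add: marg marg' sum.distrib)
  have 2: "pair (\<lambda>j i x y. \<i> * H j i x y - \<i> * cnj (H j i y x)) = 0"
    unfolding pair_def D_def
    by (rule hom_functional_vanishes_hermitian[OF dB t[unfolded pair_def D_def]])
      (simp_all add: marg marg' sum_subtractf sum_distrib_left[symmetric])
  have "2 * pair H = pair (\<lambda>j i x y. H j i x y + cnj (H j i y x))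
      - \<i> * pair (\<lambda>j i x y. \<i> * H j i x y - \<i> * cnj (H j i y x))"
    unfolding pair_def sum_distrib_left sum_subtractf[symmetric]
    by (intro sum.cong refl) (simp add: algebra_simps)
  then show ?thesis using 1 2 by simp
qed

text \<open>Such a functional depends only on the marginal, hence its kernel has the form \<open>1 \<otimes> R\<close>.\<close>
lemma hom_functional_constant_imp_tensor:
  fixes dA :: "'i::finite \<Rightarrow> nat" and dB :: "'j::finite \<Rightarrow> nat"
    and t :: "'j \<Rightarrow> 'i \<Rightarrow> nat \<times> nat \<Rightarrow> nat \<times> nat \<Rightarrow> complex"
  defines "D \<equiv> \<lambda>j i. {..<dB j} \<times> {..<dA i}"
  defines "pair \<equiv> \<lambda>H. \<Sum>j\<in>UNIV. \<Sum>i\<in>UNIV. \<Sum>x\<in>D j i. \<Sum>y\<in>D j i. H j i x y * t j i x y"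
  assumes dB: "\<And>j. dB j > 0"
    and t: "\<And>H. (\<And>j i. psd_form (D j i) (H j i)) \<Longrightarrow>
        (\<And>i a a'. a < dA i \<Longrightarrow> a' < dA i \<Longrightarrow>
          (\<Sum>j\<in>UNIV. \<Sum>b<dB j. H j i (b, a) (b, a')) = (if a = a' then 1 else 0)) \<Longrightarrow> pair H = c"
    and lt: "b < dB j" "b' < dB j" "a < dA i" "a' < dA i"
  shows "t j i (b, a) (b', a') = (if b = b' then t j0 i (0, a) (0, a') else 0)"
proof -
  \<comment> \<open>Matrix units in the blocks over the fixed \<open>i\<close>; pairing with one of
    them reads off an entry of \<open>t\<close>.\<close>
  define E :: "'j \<Rightarrow> nat \<times> nat \<Rightarrow> nat \<times> nat \<Rightarrow> 'j \<Rightarrow> 'i \<Rightarrow> nat \<times> nat \<Rightarrow> nat \<times> nat \<Rightarrow> complex" where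
    "E j0 x0 y0 = (\<lambda>j i' x y. if j = j0 \<and> i' = i \<and> x = x0 \<and> y = y0 then 1 else 0)" for j0 x0 y0
  have E: "pair (E j0 x0 y0) = t j0 i x0 y0" if "x0 \<in> D j0 i" "y0 \<in> D j0 i" for j0 x0 y0
  proof -
    have "pair (E j0 x0 y0) = (\<Sum>i'\<in>UNIV. \<Sum>x\<in>D j0 i'. \<Sum>y\<in>D j0 i'. E j0 x0 y0 j0 i' x y * t j0 i' x y)"
      unfolding pair_def by (rule sum_eq_single) (auto simp: E_def)
    also have "\<dots> = (\<Sum>x\<in>D j0 i. \<Sum>y\<in>D j0 i. E j0 x0 y0 j0 i x y * t j0 i x y)"
      by (rule sum_eq_single) (auto simp: E_def)
    also have "\<dots> = (\<Sum>y\<in>D j0 i. E j0 x0 y0 j0 i x0 y * t j0 i x0 y)"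
      by (rule sum_eq_single) (use that in \<open>auto simp: E_def D_def\<close>)
    also have "\<dots> = E j0 x0 y0 j0 i x0 y0 * t j0 i x0 y0"
      by (rule sum_eq_single) (use that in \<open>auto simp: E_def D_def\<close>)
    finally show ?thesis by (simp add: E_def)
  qed
  have mE: "(\<Sum>j\<in>UNIV. \<Sum>c<dB j. E j0 (b0, a) (b1, a') j i' (c, u) (c, u'))
      = (if i' = i \<and> u = a \<and> u' = a' \<and> b0 = b1 then 1 else 0)" if "b0 < dB j0" for j0 b0 b1 i' u u'
  proof -
    have "(\<Sum>j\<in>UNIV. \<Sum>c<dB j. E j0 (b0, a) (b1, a') j i' (c, u) (c, u'))
        = (\<Sum>c<dB j0. E j0 (b0, a) (b1, a') j0 i' (c, u) (c, u'))"
      by (rule sum_eq_single) (auto simp: E_def)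
    also have "\<dots> = E j0 (b0, a) (b1, a') j0 i' (b0, u) (b0, u')"
      by (rule sum_eq_single) (use that in \<open>auto simp: E_def\<close>)
    finally show ?thesis by (auto simp: E_def)
  qed
  define s :: complex where "s = (if b = b' then 1 else 0)"
  \<comment> \<open>For b = b' the two units have the same marginal; for b and b' distinct the first
    has marginal 0 and \<open>s\<close> removes the second. In either case \<open>H\<close> has
    marginal 0.\<close>
  define H where "H j' i' x y = E j (b, a) (b', a') j' i' x y - s * E j0 (0, a) (0, a') j' i' x y" for j' i' x y
  have "pair H = 0"
    unfolding pair_def D_def
  proof (rule hom_functional_vanishes[OF dB t[unfolded pair_def D_def]])
    fix i' u u'
    show "(\<Sum>j\<in>UNIV. \<Sum>b<dB j. H j i' (b, u) (b, u')) = 0"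
      unfolding H_def sum_subtractf sum_distrib_left[symmetric] mE[OF lt(1)] mE[OF dB]
      by (simp add: s_def)
  qed
  moreover have "pair H = pair (E j (b, a) (b', a')) - s * pair (E j0 (0, a) (0, a'))"
    unfolding pair_def H_def by (simp add: sum_subtractf sum_distrib_left algebra_simps)
  ultimately show ?thesis
    using E[of "(b, a)" j "(b', a')"] E[of "(0, a)" j0 "(0, a')"] lt dB[of j0] by (simp add: D_def s_def)
qed

section \<open>Factorization through a purification\<close>

text \<open>A kernel whose marginal is \<open>1 \<otimes> R\<close> factors through a purification \<open>w\<close> of \<open>R\<close>: with a left
  inverse \<open>v\<close> of \<open>w\<close> on its range one compresses \<open>M\<close> by \<open>v\<close>, and completes the result on the unused
  dimensions of the purifying space by a fixed pure state.\<close>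
lemma psd_form_purification_factorization:
  fixes M :: "'l::finite \<Rightarrow> 'j::finite \<Rightarrow> (nat \<times> nat) \<times> 'x \<Rightarrow> (nat \<times> nat) \<times> 'x \<Rightarrow> complex"
    and R :: "'x \<Rightarrow> 'x \<Rightarrow> complex" and dD :: "'l \<Rightarrow> nat" and dB :: "'j \<Rightarrow> nat"
  assumes X: "finite X" "card X \<le> p"
    and dB: "\<And>j. dB j > 0" and dD: "\<And>l. dD l > 0"
    and M: "\<And>l j. psd_form (({..<dD l} \<times> {..<dB j}) \<times> X) (M l j)"
    and marg: "\<And>j b b' x x'. b < dB j \<Longrightarrow> b' < dB j \<Longrightarrow> x \<in> X \<Longrightarrow> x' \<in> X \<Longrightarrow>
      (\<Sum>l\<in>UNIV. \<Sum>\<gamma><dD l. M l j ((\<gamma>, b), x) ((\<gamma>, b'), x')) = (if b = b' then R x x' else 0)"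
  shows "\<exists>w g. (\<forall>x\<in>X. \<forall>x'\<in>X. R x x' = (\<Sum>q<p. w q x * cnj (w q x'))) \<and>
    (\<forall>l j. psd_form (({..<dD l} \<times> {..<dB j}) \<times> {..<p}) (g l j)) \<and>
    (\<forall>j. \<forall>b<dB j. \<forall>b'<dB j. \<forall>q<p. \<forall>q'<p.
      (\<Sum>l\<in>UNIV. \<Sum>\<gamma><dD l. g l j ((\<gamma>, b), q) ((\<gamma>, b'), q')) = (if b = b' \<and> q = q' then 1 else 0)) \<and>
    (\<forall>l j. \<forall>c\<in>{..<dD l} \<times> {..<dB j}. \<forall>c'\<in>{..<dD l} \<times> {..<dB j}. \<forall>x\<in>X. \<forall>x'\<in>X.
      M l j (c, x) (c', x') = (\<Sum>q<p. \<Sum>q'<p. w q x * cnj (w q' x') * g l j (c, q) (c', q')))"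
proof -
  \<comment> \<open>Arbitrary but fixed labels: positivity of \<open>R\<close> is read off from the
    marginal at \<open>j0\<close>, and \<open>l0\<close> is the block that receives the completing
    pure state.\<close>
  define j0 :: 'j where "j0 = undefined"
  define l0 :: 'l where "l0 = undefined"
  define A where "A l j = ({..<dD l} \<times> {..<dB j}) \<times> X" for l j
  have finA: "finite (A l j)" for l j using X by (simp add: A_def)
  note M = M[folded A_def]
  have "psd_form X (\<lambda>x x'. M l j ((\<gamma>, 0), x) ((\<gamma>, 0), x'))" if "\<gamma> < dD l" for l j \<gamma>
    by (rule psd_form_pullback[OF finA M]) (use that dB in \<open>auto simp: A_def\<close>)
  then have "psd_form X (\<lambda>x x'. \<Sum>l\<in>UNIV. \<Sum>\<gamma><dD l. M l j0 ((\<gamma>, 0), x) ((\<gamma>, 0), x'))"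
    by (intro psd_form_sum) simp
  then have "psd_form X R"
    using psd_form_cong[of X R "\<lambda>x x'. \<Sum>l\<in>UNIV. \<Sum>\<gamma><dD l. M l j0 ((\<gamma>, 0), x) ((\<gamma>, 0), x')"]
      marg[OF dB dB, where j = j0] by simp
  from psd_form_rank_factorization[OF X(1) this] obtain r w0 v0 where
    r: "r \<le> card X" and w0: "\<forall>x\<in>X. \<forall>y\<in>X. R x y = (\<Sum>c<r. w0 c x * cnj (w0 c y))"
    and v0: "\<forall>c<r. \<forall>e<r. (\<Sum>x\<in>X. v0 c x * w0 e x) = (if c = e then 1 else 0)"
    by blast
  \<comment> \<open>Padding by 0 fills the memory up to dimension \<open>p\<close>, so
    \<open>v\<close> applied to \<open>w\<close> gives the projection onto the first
    \<open>r\<close> coordinates.\<close>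
  define w where "w q x = (if q < r then w0 q x else 0)" for q x
  define v where "v q x = (if q < r then v0 q x else 0)" for q x
  have rp: "r \<le> p" using r X by simp
  have Rw: "R x y = (\<Sum>q<p. w q x * cnj (w q y))" if "x \<in> X" "y \<in> X" for x y
  proof -
    have "(\<Sum>q<p. w q x * cnj (w q y)) = (\<Sum>q<r. w q x * cnj (w q y))"
      by (rule sum.mono_neutral_right) (use rp in \<open>auto simp: w_def\<close>)
    then show ?thesis using w0 that by (simp add: w_def)
  qed
  have vw: "(\<Sum>x\<in>X. v c x * w e x) = (if c = e \<and> c < r then 1 else 0)" for c e
    using v0 by (cases "c < r"; cases "e < r") (auto simp: w_def v_def)
  \<comment> \<open>The product of \<open>w\<close> and \<open>v\<close> is a possibly oblique
    projection onto the range of \<open>w\<close>. The facts \<open>right\<close> and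
    \<open>left\<close> show that it fixes \<open>M\<close> from either side.\<close>
  define P where "P x z = (\<Sum>q<p. w q x * v q z)" for x z
  have Pw: "(\<Sum>z\<in>X. P x z * w e z) = w e x" if "e < p" for x e
  proof -
    have "(\<Sum>z\<in>X. P x z * w e z) = (\<Sum>z\<in>X. \<Sum>q<p. w q x * (v q z * w e z))"
      by (simp add: P_def sum_distrib_right mult.assoc)
    also have "\<dots> = (\<Sum>q<p. w q x * (\<Sum>z\<in>X. v q z * w e z))"
      by (subst sum.swap) (simp add: sum_distrib_left)
    also have "\<dots> = (\<Sum>q<p. if q = e then w e x else 0)"
      unfolding vw by (intro sum.cong refl) (auto simp: w_def)
    also have "\<dots> = w e x" using that by simp
    finally show ?thesis .
  qed
  \<comment> \<open>Since R is w times its adjoint, the form of \<open>R\<close> vanishes at column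
    \<open>x\<close> of 1 minus the adjoint of \<open>P\<close>. This form is a sum over
    \<open>l\<close> and \<gamma> of nonnegative forms of blocks of \<open>M\<close>, so each of
    them is 0 and \<open>M\<close> itself annihilates the vector.\<close>
  have right: "(\<Sum>z\<in>X. M l j m (c, z) * cnj (P x z)) = M l j m (c, x)"
    if m: "m \<in> A l j" and c: "c \<in> {..<dD l} \<times> {..<dB j}" and x: "x \<in> X" for l j m c x
  proof -
    obtain \<gamma> b where cb: "c = (\<gamma>, b)" "\<gamma> < dD l" "b < dB j" using c by auto
    define u where "u z = (if z = x then 1 else 0) - cnj (P x z)" for z
    define f where "f l \<gamma> = (\<Sum>z\<in>X. \<Sum>z'\<in>X. cnj (u z) * M l j ((\<gamma>, b), z) ((\<gamma>, b), z') * u z')" for l \<gamma>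
    have uw: "(\<Sum>z\<in>X. cnj (w e z) * u z) = 0" if "e < p" for e
    proof -
      have "(\<Sum>z\<in>X. cnj (w e z) * u z)
          = (\<Sum>z\<in>X. (if z = x then cnj (w e x) else 0) - cnj (P x z * w e z))"
        by (intro sum.cong refl) (simp add: u_def algebra_simps)
      also have "\<dots> = cnj (w e x) - cnj (\<Sum>z\<in>X. P x z * w e z)"
        using x X by (simp add: sum_subtractf)
      finally show ?thesis by (simp add: Pw that)
    qed
    have f0: "0 \<le> f l \<gamma>" if "\<gamma> < dD l" for l \<gamma>
      unfolding f_def
      by (rule psd_formD, rule psd_form_pullback[OF finA M]) (use that cb in \<open>auto simp: A_def\<close>)
    have "(\<Sum>l\<in>UNIV. \<Sum>\<gamma><dD l. f l \<gamma>)
        = (\<Sum>l\<in>UNIV. \<Sum>z\<in>X. \<Sum>\<gamma><dD l. \<Sum>z'\<in>X. cnj (u z) * M l j ((\<gamma>, b), z) ((\<gamma>, b), z') * u z')"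
      unfolding f_def by (intro sum.cong refl sum.swap)
    also have "\<dots> = (\<Sum>z\<in>X. \<Sum>l\<in>UNIV. \<Sum>\<gamma><dD l. \<Sum>z'\<in>X. cnj (u z) * M l j ((\<gamma>, b), z) ((\<gamma>, b), z') * u z')"
      by (rule sum.swap)
    also have "\<dots> = (\<Sum>z\<in>X. \<Sum>l\<in>UNIV. \<Sum>z'\<in>X. \<Sum>\<gamma><dD l. cnj (u z) * M l j ((\<gamma>, b), z) ((\<gamma>, b), z') * u z')"
      by (intro sum.cong refl sum.swap)
    also have "\<dots> = (\<Sum>z\<in>X. \<Sum>z'\<in>X. \<Sum>l\<in>UNIV. \<Sum>\<gamma><dD l. cnj (u z) * M l j ((\<gamma>, b), z) ((\<gamma>, b), z') * u z')"
      by (intro sum.cong refl sum.swap)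
    also have "\<dots> = (\<Sum>z\<in>X. \<Sum>z'\<in>X. cnj (u z) * R z z' * u z')"
      using marg[OF cb(3) cb(3)] by (simp add: sum_distrib_left[symmetric] sum_distrib_right[symmetric])
    also have "\<dots> = 0"
      by (subst gram_form_eq[where I = "{..<p}" and w = w]) (simp_all add: Rw uw)
    finally have "(\<Sum>l\<in>UNIV. \<Sum>\<gamma><dD l. f l \<gamma>) = 0" .
    then have "(\<Sum>\<gamma><dD l. f l \<gamma>) = 0"
      by (subst (asm) sum_nonneg_eq_0_iff) (auto intro!: sum_nonneg f0)
    then have "f l \<gamma> = 0"
      by (subst (asm) sum_nonneg_eq_0_iff) (use f0 cb in auto)
    then have "(\<Sum>z\<in>X. M l j m ((\<gamma>, b), z) * u z) = 0"
      unfolding f_def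
      by (intro psd_form_null_vector[OF finA M _ _ m]) (use cb in \<open>auto simp: A_def\<close>)
    moreover have "(\<Sum>z\<in>X. M l j m ((\<gamma>, b), z) * u z)
        = (\<Sum>z\<in>X. (if z = x then M l j m ((\<gamma>, b), x) else 0) - M l j m ((\<gamma>, b), z) * cnj (P x z))"
      by (intro sum.cong refl) (simp add: u_def algebra_simps)
    ultimately show ?thesis
      using x X by (simp add: cb(1) sum_subtractf)
  qed
  have left: "(\<Sum>z\<in>X. P x z * M l j (c, z) m) = M l j (c, x) m"
    if "m \<in> A l j" "c \<in> {..<dD l} \<times> {..<dB j}" "x \<in> X" for l j m c x
  proof -
    have h: "M l j (c, z) m = cnj (M l j m (c, z))" if "z \<in> X" for z
      using psd_form_hermitian[OF finA M \<open>m \<in> A l j\<close>] that \<open>c \<in> _\<close> by (simp add: A_def)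
    have "(\<Sum>z\<in>X. P x z * M l j (c, z) m) = (\<Sum>z\<in>X. cnj (M l j m (c, z) * cnj (P x z)))"
      by (intro sum.cong refl) (simp add: h)
    also have "\<dots> = cnj (M l j m (c, x))"
      using right[OF that] by (simp only: cnj_sum[symmetric])
    finally show ?thesis using h that by simp
  qed
  \<comment> \<open>Compression of \<open>M\<close> by \<open>v\<close>; its marginal is the
    identity on the first \<open>r\<close> memory coordinates only.\<close>
  define g1 where "g1 l j = (\<lambda>(c, q) (c', q'). \<Sum>z\<in>X. \<Sum>z'\<in>X. v q z * M l j (c, z) (c', z') * cnj (v q' z'))" for l j
  \<comment> \<open>On the remaining memory coordinates the output is the basis vector 0 of block
    \<open>l0\<close>, whatever \<open>b\<close> is. This contributes exactly the missing part of
    the identity to the marginal.\<close>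
  define F where "F l m \<longleftrightarrow> l = l0 \<and> fst (fst m) = 0 \<and> \<not> snd m < r" for l and m :: "(nat \<times> nat) \<times> nat"
  define g2 :: "'l \<Rightarrow> (nat \<times> nat) \<times> nat \<Rightarrow> (nat \<times> nat) \<times> nat \<Rightarrow> complex"
    where "g2 l m m' = (if m = m' \<and> F l m then 1 else 0)" for l m m'
  define g where "g l j m m' = g1 l j m m' + g2 l m m'" for l j m m'
  show ?thesis
  proof (intro exI[of _ w] exI[of _ g] conjI ballI allI impI)
    fix x x' assume "x \<in> X" "x' \<in> X"
    then show "R x x' = (\<Sum>q<p. w q x * cnj (w q x'))" by (rule Rw)
  next
    fix l j
    have "psd_form (({..<dD l} \<times> {..<dB j}) \<times> {..<p}) (g1 l j)"
      unfolding g1_def by (rule psd_form_congruence) (use X M in \<open>auto simp: A_def\<close>)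
    moreover have "psd_form (({..<dD l} \<times> {..<dB j}) \<times> {..<p}) (g2 l)"
      unfolding g2_def by (rule psd_form_diagonal) simp
    ultimately show "psd_form (({..<dD l} \<times> {..<dB j}) \<times> {..<p}) (g l j)"
      unfolding g_def by (rule psd_form_add)
  next
    fix j b b' q q' assume b: "b < dB j" "b' < dB j" and q: "q < p" "q' < p"
    have "(\<Sum>l\<in>UNIV. \<Sum>\<gamma><dD l. g1 l j ((\<gamma>, b), q) ((\<gamma>, b'), q'))
      = (\<Sum>l\<in>UNIV. \<Sum>z\<in>X. \<Sum>\<gamma><dD l. \<Sum>z'\<in>X. v q z * M l j ((\<gamma>, b), z) ((\<gamma>, b'), z') * cnj (v q' z'))"
      unfolding g1_def prod.case by (intro sum.cong refl sum.swap)
    also have "\<dots> = (\<Sum>z\<in>X. \<Sum>l\<in>UNIV. \<Sum>\<gamma><dD l. \<Sum>z'\<in>X. v q z * M l j ((\<gamma>, b), z) ((\<gamma>, b'), z') * cnj (v q' z'))"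
      by (rule sum.swap)
    also have "\<dots> = (\<Sum>z\<in>X. \<Sum>l\<in>UNIV. \<Sum>z'\<in>X. \<Sum>\<gamma><dD l. v q z * M l j ((\<gamma>, b), z) ((\<gamma>, b'), z') * cnj (v q' z'))"
      by (intro sum.cong refl sum.swap)
    also have "\<dots> = (\<Sum>z\<in>X. \<Sum>z'\<in>X. \<Sum>l\<in>UNIV. \<Sum>\<gamma><dD l. v q z * M l j ((\<gamma>, b), z) ((\<gamma>, b'), z') * cnj (v q' z'))"
      by (intro sum.cong refl sum.swap)
    also have "\<dots> = (\<Sum>z\<in>X. \<Sum>z'\<in>X. v q z * (if b = b' then R z z' else 0) * cnj (v q' z'))"
      using marg[OF b] by (simp add: sum_distrib_left[symmetric] sum_distrib_right[symmetric])
    also have "\<dots> = (if b = b' then \<Sum>z\<in>X. \<Sum>z'\<in>X. v q z * R z z' * cnj (v q' z') else 0)"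
      by simp
    \<comment> \<open>Substituting the factorization of \<open>R\<close> gives the product of v w
      and its adjoint, where v w is the projection onto the first \<open>r\<close>
      coordinates.\<close>
    also have "(\<Sum>z\<in>X. \<Sum>z'\<in>X. v q z * R z z' * cnj (v q' z'))
        = (\<Sum>z\<in>X. \<Sum>z'\<in>X. \<Sum>e<p. (v q z * w e z) * cnj (v q' z' * w e z'))"
      by (intro sum.cong refl) (simp add: Rw sum_distrib_left sum_distrib_right mult_ac)
    also have "\<dots> = (\<Sum>z\<in>X. \<Sum>e<p. \<Sum>z'\<in>X. (v q z * w e z) * cnj (v q' z' * w e z'))"
      by (intro sum.cong refl sum.swap)
    also have "\<dots> = (\<Sum>e<p. \<Sum>z\<in>X. \<Sum>z'\<in>X. (v q z * w e z) * cnj (v q' z' * w e z'))"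
      by (rule sum.swap)
    also have "\<dots> = (\<Sum>e<p. (\<Sum>z\<in>X. v q z * w e z) * cnj (\<Sum>z'\<in>X. v q' z' * w e z'))"
      by (simp add: sum_product)
    also have "\<dots> = (\<Sum>e<p. if e = q then (if q = q' \<and> q < r then 1 else 0) else 0)"
      unfolding vw by (intro sum.cong refl) auto
    also have "\<dots> = (if q = q' \<and> q < r then 1 else 0)" using q by simp
    finally have g1: "(\<Sum>l\<in>UNIV. \<Sum>\<gamma><dD l. g1 l j ((\<gamma>, b), q) ((\<gamma>, b'), q'))
      = (if b = b' then if q = q' \<and> q < r then 1 else 0 else 0)" .
    have "(\<Sum>l\<in>UNIV. \<Sum>\<gamma><dD l. g2 l ((\<gamma>, b), q) ((\<gamma>, b'), q'))
        = (\<Sum>\<gamma><dD l0. g2 l0 ((\<gamma>, b), q) ((\<gamma>, b'), q'))"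
      by (rule sum_eq_single) (auto simp: g2_def F_def)
    also have "\<dots> = g2 l0 ((0, b), q) ((0, b'), q')"
      by (rule sum_eq_single) (use dD in \<open>auto simp: g2_def F_def\<close>)
    finally show "(\<Sum>l\<in>UNIV. \<Sum>\<gamma><dD l. g l j ((\<gamma>, b), q) ((\<gamma>, b'), q')) = (if b = b' \<and> q = q' then 1 else 0)"
      by (auto simp: g_def sum.distrib g1 g2_def F_def)
  next
    fix l j c c' x x' assume c: "c \<in> {..<dD l} \<times> {..<dB j}" "c' \<in> {..<dD l} \<times> {..<dB j}"
      and x: "x \<in> X" "x' \<in> X"
    \<comment> \<open>The completion drops out, because \<open>w q\<close> is 0 for q at least
      \<open>r\<close>, which is where \<open>g2\<close> lives. What remains is \<open>M\<close>
      multiplied by \<open>P\<close> on the left and by its adjoint on the right, which is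
      \<open>M\<close> again.\<close>
    have "w q x * cnj (w q' x') * g l j (c, q) (c', q') = w q x * cnj (w q' x') * g1 l j (c, q) (c', q')" for q q'
      by (auto simp: g_def g2_def F_def w_def)
    then have "(\<Sum>q<p. \<Sum>q'<p. w q x * cnj (w q' x') * g l j (c, q) (c', q'))
        = (\<Sum>q<p. \<Sum>q'<p. \<Sum>z\<in>X. \<Sum>z'\<in>X. (w q x * v q z) * (M l j (c, z) (c', z') * cnj (w q' x' * v q' z')))"
      by (simp add: g1_def sum_distrib_left mult_ac)
    also have "\<dots> = (\<Sum>q<p. \<Sum>z\<in>X. \<Sum>q'<p. \<Sum>z'\<in>X. (w q x * v q z) * (M l j (c, z) (c', z') * cnj (w q' x' * v q' z')))"
      by (intro sum.cong refl sum.swap)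
    also have "\<dots> = (\<Sum>z\<in>X. \<Sum>q<p. \<Sum>q'<p. \<Sum>z'\<in>X. (w q x * v q z) * (M l j (c, z) (c', z') * cnj (w q' x' * v q' z')))"
      by (rule sum.swap)
    also have "\<dots> = (\<Sum>z\<in>X. \<Sum>q<p. \<Sum>z'\<in>X. \<Sum>q'<p. (w q x * v q z) * (M l j (c, z) (c', z') * cnj (w q' x' * v q' z')))"
      by (intro sum.cong refl sum.swap)
    also have "\<dots> = (\<Sum>z\<in>X. P x z * (\<Sum>z'\<in>X. M l j (c, z) (c', z') * cnj (P x' z')))"
      by (simp only: P_def cnj_sum sum_distrib_left[symmetric] sum_distrib_right[symmetric])
    also have "\<dots> = (\<Sum>z\<in>X. P x z * M l j (c, z) (c', x'))"
      by (intro sum.cong refl) (use c x in \<open>simp add: right A_def\<close>)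
    also have "\<dots> = M l j (c, x) (c', x')"
      using c x by (simp add: left A_def)
    finally show "M l j (c, x) (c', x') = (\<Sum>q<p. \<Sum>q'<p. w q x * cnj (w q' x') * g l j (c, q) (c', q'))" ..
  qed
qed

section \<open>The kernel of a supermap\<close>

text \<open>The Choi kernel of \<open>S\<close> with its indices regrouped: \<gamma> and b belong to
  the outputs D and B, \<alpha> and a to the inputs C and A. The first pair stays with the decoder,
  the second pair is replaced by the memory.\<close>

definition supermap_kernel :: "('i \<Rightarrow> nat) \<Rightarrow> ('j \<Rightarrow> nat) \<Rightarrow> ('k \<Rightarrow> nat) \<Rightarrow>
    (('j \<times> 'i \<Rightarrow> complex mat) \<Rightarrow> ('l \<times> 'k \<Rightarrow> complex mat)) \<Rightarrow> 'k \<Rightarrow> 'i \<Rightarrow> 'l \<Rightarrow> 'j \<Rightarrow>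
    (nat \<times> nat) \<times> (nat \<times> nat) \<Rightarrow> (nat \<times> nat) \<times> (nat \<times> nat) \<Rightarrow> complex" where
  "supermap_kernel dA dB dC S k i l j = (\<lambda>((\<gamma>, b), (\<alpha>, a)) ((\<gamma>', b'), (\<alpha>', a')).
     S (munit (homdim dA dB) (j, i) (b * dA i + a) (b' * dA i + a')) (l, k)
       $$ (\<gamma> * dC k + \<alpha>, \<gamma>' * dC k + \<alpha>'))"

lemma sum_lessThan_mult_pair:
  "(\<Sum>r<n * (m::nat). f r :: 'a::comm_monoid_add) = (\<Sum>(b, a)\<in>{..<n} \<times> {..<m}. f (b * m + a))"
  by (simp add: sum_lessThan_mult sum.cartesian_product)

lemma sum_lessThan_mult_pairs:
  "(\<Sum>r<n * (m::nat). \<Sum>s<n * m. f r s :: 'a::comm_monoid_add)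
    = (\<Sum>(b, a)\<in>{..<n} \<times> {..<m}. \<Sum>(b', a')\<in>{..<n} \<times> {..<m}. f (b * m + a) (b' * m + a'))"
  by (simp add: sum_lessThan_mult_pair split_def)

lemma supermap_index_expand:
  fixes dA :: "'i::finite \<Rightarrow> nat" and dB :: "'j::finite \<Rightarrow> nat"
  assumes "lin_map (homdim dA dB) (homdim dC dD) S" "elem (homdim dA dB) X"
    and "\<gamma> < dD l" "\<gamma>' < dD l" "\<alpha> < dC k" "\<alpha>' < dC k"
  shows "S X (l, k) $$ (\<gamma> * dC k + \<alpha>, \<gamma>' * dC k + \<alpha>')
    = (\<Sum>j\<in>UNIV. \<Sum>i\<in>UNIV. \<Sum>(b, a)\<in>{..<dB j} \<times> {..<dA i}. \<Sum>(b', a')\<in>{..<dB j} \<times> {..<dA i}.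
        X (j, i) $$ (b * dA i + a, b' * dA i + a')
          * supermap_kernel dA dB dC S k i l j ((\<gamma>, b), (\<alpha>, a)) ((\<gamma>', b'), (\<alpha>', a')))"
proof -
  have "S X (l, k) $$ (\<gamma> * dC k + \<alpha>, \<gamma>' * dC k + \<alpha>')
    = (\<Sum>ji\<in>UNIV \<times> UNIV. \<Sum>r<homdim dA dB ji. \<Sum>s<homdim dA dB ji. X ji $$ (r, s)
        * S (munit (homdim dA dB) ji r s) (l, k) $$ (\<gamma> * dC k + \<alpha>, \<gamma>' * dC k + \<alpha>'))"
    unfolding UNIV_Times_UNIV
    by (rule lin_map_index_expand[OF assms(1,2)]) (use assms in \<open>auto simp: homdim_def mult_add_less_mult\<close>)
  also have "\<dots> = (\<Sum>j\<in>UNIV. \<Sum>i\<in>UNIV. \<Sum>r<dB j * dA i. \<Sum>s<dB j * dA i. X (j, i) $$ (r, s)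
        * S (munit (homdim dA dB) (j, i) r s) (l, k) $$ (\<gamma> * dC k + \<alpha>, \<gamma>' * dC k + \<alpha>'))"
    unfolding sum.cartesian_product' by (simp add: homdim_def)
  finally show ?thesis
    unfolding sum_lessThan_mult_pairs supermap_kernel_def prod.case .
qed

lemma psd_form_supermap_kernel:
  assumes "comp_pos (homdim dA dB) (homdim dC dD) S" "dA i > 0" "dB j > 0"
  shows "psd_form (({..<dD l} \<times> {..<dB j}) \<times> ({..<dC k} \<times> {..<dA i})) (supermap_kernel dA dB dC S k i l j)"
proof -
  have "psd_form ({..<dD l * dC k} \<times> {..<dB j * dA i})
      (\<lambda>(r, a) (s, b). S (munit (homdim dA dB) (j, i) a b) (l, k) $$ (r, s))"
    using comp_pos_choi_psd[OF assms(1), of "(j, i)" "(l, k)"] assms by (simp add: homdim_def)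
  from psd_form_pullback[OF _ this, where f = "\<lambda>((\<gamma>, b), (\<alpha>, a)). (\<gamma> * dC k + \<alpha>, b * dA i + a)"
      and A = "({..<dD l} \<times> {..<dB j}) \<times> ({..<dC k} \<times> {..<dA i})"]
  show ?thesis
    by (auto simp: supermap_kernel_def case_prod_unfold mult_add_less_mult)
qed

text \<open>Entry (\<alpha>, \<alpha>') of (TP) for \<open>S X\<close>, read as a linear functional
  of \<open>X\<close>: it takes one value on all channels. This is the hypothesis that
  \<open>hom_functional_constant_imp_tensor\<close> asks for.\<close>

lemma det_supermap_kernel_functional:
  fixes dA :: "'i::finite \<Rightarrow> nat" and dB :: "'j::finite \<Rightarrow> nat"
    and dC :: "'k::finite \<Rightarrow> nat" and dD :: "'l::finite \<Rightarrow> nat"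
  assumes S: "det_supermap dA dB dC dD S" and dA: "\<And>i. dA i > 0"
    and lt: "\<alpha> < dC k" "\<alpha>' < dC k"
    and H: "\<And>j i. psd_form ({..<dB j} \<times> {..<dA i}) (H j i)"
    and marg: "\<And>i a a'. a < dA i \<Longrightarrow> a' < dA i \<Longrightarrow>
      (\<Sum>j\<in>UNIV. \<Sum>b<dB j. H j i (b, a) (b, a')) = (if a = a' then 1 else 0)"
  shows "(\<Sum>j\<in>UNIV. \<Sum>i\<in>UNIV. \<Sum>x\<in>{..<dB j} \<times> {..<dA i}. \<Sum>y\<in>{..<dB j} \<times> {..<dA i}.
      H j i x y * (\<Sum>l\<in>UNIV. \<Sum>\<gamma><dD l. supermap_kernel dA dB dC S k i l j
        ((\<gamma>, fst x), (\<alpha>, snd x)) ((\<gamma>, fst y), (\<alpha>', snd y)))) = (if \<alpha> = \<alpha>' then 1 else 0)"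
proof -
  define X where "X = (\<lambda>(j, i). mat (dB j * dA i) (dB j * dA i)
    (\<lambda>(r, s). H j i (r div dA i, r mod dA i) (s div dA i, s mod dA i)))"
  have XH: "X (j, i) $$ (b * dA i + a, b' * dA i + a') = H j i (b, a) (b', a')"
    if "b < dB j" "b' < dB j" "a < dA i" "a' < dA i" for j i b a b' a'
    using that by (simp add: X_def mult_add_less_mult)
  have X: "elem (homdim dA dB) X" by (auto simp: elem_def X_def homdim_def)
  have "psd (dB j * dA i) (X (j, i))" for j i
  proof -
    have "psd_form {..<dB j * dA i} (\<lambda>a b. X (j, i) $$ (a, b))
      \<longleftrightarrow> psd_form {..<dB j * dA i} (\<lambda>r s. H j i (r div dA i, r mod dA i) (s div dA i, s mod dA i))"
      by (rule psd_form_cong) (simp add: X_def)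
    then show ?thesis
      using H[of j i] unfolding psd_iff_psd_form psd_form_div_mod_iff[OF dA] by (simp add: X_def)
  qed
  then have "elem_pos (homdim dA dB) X"
    using X by (auto simp: elem_pos_def homdim_def)
  moreover have "TP_cond dA dB X"
    unfolding TP_cond_def using marg by (auto simp: XH)
  ultimately have TP: "TP_cond dC dD (S X)" and lin: "lin_map (homdim dA dB) (homdim dC dD) S"
    using S by (auto simp: det_supermap_def)
  let ?D = "\<lambda>j i. {..<dB j} \<times> {..<dA i}"
  let ?K = "\<lambda>j i x y l \<gamma>. supermap_kernel dA dB dC S k i l j ((\<gamma>, fst x), (\<alpha>, snd x)) ((\<gamma>, fst y), (\<alpha>', snd y))"
  let ?P = "Sigma UNIV (\<lambda>j. Sigma UNIV (\<lambda>i. ?D j i \<times> ?D j i))" and ?L = "Sigma UNIV (\<lambda>l. {..<dD l})"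
  have P: "(\<Sum>j\<in>UNIV. \<Sum>i\<in>UNIV. \<Sum>x\<in>?D j i. \<Sum>y\<in>?D j i. f j i x y) = (\<Sum>(j, i, x, y)\<in>?P. f j i x y)"
    for f :: "'j \<Rightarrow> 'i \<Rightarrow> nat \<times> nat \<Rightarrow> nat \<times> nat \<Rightarrow> complex"
    by (simp add: sum.Sigma)
  have L: "(\<Sum>l\<in>UNIV. \<Sum>\<gamma><dD l. f l \<gamma>) = (\<Sum>(l, \<gamma>)\<in>?L. f l \<gamma>)" for f :: "'l \<Rightarrow> nat \<Rightarrow> complex"
    by (simp add: sum.Sigma)
  have "(if \<alpha> = \<alpha>' then 1 else 0)
      = (\<Sum>l\<in>UNIV. \<Sum>\<gamma><dD l. S X (l, k) $$ (\<gamma> * dC k + \<alpha>, \<gamma> * dC k + \<alpha>'))"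
    using TP lt by (simp add: TP_cond_def)
  also have "\<dots> = (\<Sum>l\<in>UNIV. \<Sum>\<gamma><dD l. \<Sum>j\<in>UNIV. \<Sum>i\<in>UNIV. \<Sum>x\<in>?D j i. \<Sum>y\<in>?D j i. H j i x y * ?K j i x y l \<gamma>)"
    by (intro sum.cong refl, subst supermap_index_expand[OF lin X])
      (use lt in \<open>auto intro!: sum.cong simp: XH\<close>)
  also have "\<dots> = (\<Sum>j\<in>UNIV. \<Sum>i\<in>UNIV. \<Sum>x\<in>?D j i. \<Sum>y\<in>?D j i. \<Sum>l\<in>UNIV. \<Sum>\<gamma><dD l. H j i x y * ?K j i x y l \<gamma>)"
    unfolding P L split_def by (rule sum.swap)
  also have "\<dots> = (\<Sum>j\<in>UNIV. \<Sum>i\<in>UNIV. \<Sum>x\<in>?D j i. \<Sum>y\<in>?D j i. H j i x y * (\<Sum>l\<in>UNIV. \<Sum>\<gamma><dD l. ?K j i x y l \<gamma>))"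
    by (simp only: sum_distrib_left)
  finally show ?thesis ..
qed

text \<open>For each pair (k, i), constancy on channels makes the marginal of the supermap kernel
  equal to 1 \<otimes> \<open>R k i\<close>, and the purification lemma applies with the common
  dimension \<open>p\<close>. The first conclusion becomes trace preservation of the encoder, the
  third that of the decoder.\<close>

lemma det_supermap_kernel_factorization:
  fixes dA :: "'i::finite \<Rightarrow> nat" and dB :: "'j::finite \<Rightarrow> nat"
    and dC :: "'k::finite \<Rightarrow> nat" and dD :: "'l::finite \<Rightarrow> nat"
  assumes S: "det_supermap dA dB dC dD S"
    and pos: "\<And>i. dA i > 0" "\<And>j. dB j > 0" "\<And>l. dD l > 0"
    and p: "\<And>i k. dA i * dC k \<le> p"
  obtains w :: "'k \<Rightarrow> 'i \<Rightarrow> nat \<Rightarrow> nat \<times> nat \<Rightarrow> complex"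
    and g :: "'k \<Rightarrow> 'i \<Rightarrow> 'l \<Rightarrow> 'j \<Rightarrow> (nat \<times> nat) \<times> nat \<Rightarrow> (nat \<times> nat) \<times> nat \<Rightarrow> complex"
  where "\<And>k \<alpha> \<alpha>'. \<alpha> < dC k \<Longrightarrow> \<alpha>' < dC k \<Longrightarrow>
      (\<Sum>i\<in>UNIV. \<Sum>a<dA i. \<Sum>q<p. w k i q (\<alpha>, a) * cnj (w k i q (\<alpha>', a))) = (if \<alpha> = \<alpha>' then 1 else 0)"
    and "\<And>k i l j. psd_form (({..<dD l} \<times> {..<dB j}) \<times> {..<p}) (g k i l j)"
    and "\<And>k i j b b' q q'. b < dB j \<Longrightarrow> b' < dB j \<Longrightarrow> q < p \<Longrightarrow> q' < p \<Longrightarrow>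
      (\<Sum>l\<in>UNIV. \<Sum>\<gamma><dD l. g k i l j ((\<gamma>, b), q) ((\<gamma>, b'), q')) = (if b = b' \<and> q = q' then 1 else 0)"
    and "\<And>k i l j \<gamma> \<gamma>' b b' \<alpha> \<alpha>' a a'. \<gamma> < dD l \<Longrightarrow> \<gamma>' < dD l \<Longrightarrow> b < dB j \<Longrightarrow> b' < dB j \<Longrightarrow>
      \<alpha> < dC k \<Longrightarrow> \<alpha>' < dC k \<Longrightarrow> a < dA i \<Longrightarrow> a' < dA i \<Longrightarrow>
      supermap_kernel dA dB dC S k i l j ((\<gamma>, b), (\<alpha>, a)) ((\<gamma>', b'), (\<alpha>', a'))
      = (\<Sum>q<p. \<Sum>q'<p. w k i q (\<alpha>, a) * cnj (w k i q' (\<alpha>', a')) * g k i l j ((\<gamma>, b), q) ((\<gamma>', b'), q'))"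
proof -
  define j0 :: 'j where "j0 = undefined"
  define t where "t k \<alpha> \<alpha>' j i x y = (\<Sum>l\<in>UNIV. \<Sum>\<gamma><dD l. supermap_kernel dA dB dC S k i l j
        ((\<gamma>, fst x), (\<alpha>, snd x)) ((\<gamma>, fst y), (\<alpha>', snd y)))" for k \<alpha> \<alpha>' j i x y
  define R where "R k i x y = t k (fst x) (fst y) j0 i (0, snd x) (0, snd y)" for k i x y
  note functional = det_supermap_kernel_functional[OF S pos(1), folded t_def]
  have marg: "t k \<alpha> \<alpha>' j i (b, a) (b', a') = (if b = b' then R k i (\<alpha>, a) (\<alpha>', a') else 0)"
    if "\<alpha> < dC k" "\<alpha>' < dC k" "b < dB j" "b' < dB j" "a < dA i" "a' < dA i" for k \<alpha> \<alpha>' j i b a b' a'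
    unfolding R_def fst_conv snd_conv
    by (rule hom_functional_constant_imp_tensor[OF pos(2) functional[OF that(1,2)] that(3-6)])
  have R1: "(\<Sum>i\<in>UNIV. \<Sum>a<dA i. R k i (\<alpha>, a) (\<alpha>', a)) = (if \<alpha> = \<alpha>' then 1 else 0)"
    if "\<alpha> < dC k" "\<alpha>' < dC k" for k \<alpha> \<alpha>'
  proof -
    \<comment> \<open>The channel that discards its input and prepares basis vector 0 of block
      \<open>j0\<close>. Evaluating the constant functional on it extracts the partial trace of
      \<open>R k i\<close> over A, summed over \<open>i\<close>.\<close>
    define H :: "'j \<Rightarrow> 'i \<Rightarrow> nat \<times> nat \<Rightarrow> nat \<times> nat \<Rightarrow> complex"
      where "H j i x y = (if x = y \<and> (j = j0 \<and> fst x = 0) then 1 else 0)" for j i x y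
    let ?D = "\<lambda>j i. {..<dB j} \<times> {..<dA i}"
    have "(\<Sum>j\<in>UNIV. \<Sum>b<dB j. H j i (b, a) (b, a')) = (if a = a' then 1 else 0)" for i a a'
    proof -
      have "(\<Sum>j\<in>UNIV. \<Sum>b<dB j. H j i (b, a) (b, a')) = (\<Sum>b<dB j0. H j0 i (b, a) (b, a'))"
        by (rule sum_eq_single) (auto simp: H_def)
      also have "\<dots> = H j0 i (0, a) (0, a')"
        by (rule sum_eq_single) (use pos in \<open>auto simp: H_def\<close>)
      finally show ?thesis by (simp add: H_def)
    qed
    moreover have "psd_form (?D j i) (H j i)" for j i
      unfolding H_def by (rule psd_form_diagonal) simp
    ultimately have "(if \<alpha> = \<alpha>' then 1 else 0)
        = (\<Sum>j\<in>UNIV. \<Sum>i\<in>UNIV. \<Sum>x\<in>?D j i. \<Sum>y\<in>?D j i. H j i x y * t k \<alpha> \<alpha>' j i x y)"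
      using functional[OF that, of H] by simp
    also have "\<dots> = (\<Sum>i\<in>UNIV. \<Sum>x\<in>?D j0 i. \<Sum>y\<in>?D j0 i. H j0 i x y * t k \<alpha> \<alpha>' j0 i x y)"
      by (rule sum_eq_single) (auto simp: H_def)
    also have "\<dots> = (\<Sum>i\<in>UNIV. \<Sum>x\<in>?D j0 i. H j0 i x x * t k \<alpha> \<alpha>' j0 i x x)"
      by (intro sum.cong refl sum_eq_single) (auto simp: H_def)
    also have "\<dots> = (\<Sum>i\<in>UNIV. \<Sum>b<dB j0. \<Sum>a<dA i. H j0 i (b, a) (b, a) * t k \<alpha> \<alpha>' j0 i (b, a) (b, a))"
      by (simp add: sum.cartesian_product split_def)
    also have "\<dots> = (\<Sum>i\<in>UNIV. \<Sum>a<dA i. H j0 i (0, a) (0, a) * t k \<alpha> \<alpha>' j0 i (0, a) (0, a))"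
      by (intro sum.cong refl sum_eq_single) (use pos in \<open>auto simp: H_def\<close>)
    finally show ?thesis by (simp add: H_def R_def)
  qed
  let ?X = "\<lambda>k i. {..<dC k} \<times> {..<dA i}"
  let ?C = "\<lambda>l j. {..<dD l} \<times> {..<dB j}"
  define Q where "Q k i w g \<longleftrightarrow> (\<forall>x\<in>?X k i. \<forall>x'\<in>?X k i. R k i x x' = (\<Sum>q<p. w q x * cnj (w q x'))) \<and>
    (\<forall>l j. psd_form (?C l j \<times> {..<p}) (g l j)) \<and>
    (\<forall>j. \<forall>b<dB j. \<forall>b'<dB j. \<forall>q<p. \<forall>q'<p.
      (\<Sum>l\<in>UNIV. \<Sum>\<gamma><dD l. g l j ((\<gamma>, b), q) ((\<gamma>, b'), q')) = (if b = b' \<and> q = q' then 1 else 0)) \<and>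
    (\<forall>l j. \<forall>c\<in>?C l j. \<forall>c'\<in>?C l j. \<forall>x\<in>?X k i. \<forall>x'\<in>?X k i.
      supermap_kernel dA dB dC S k i l j (c, x) (c', x')
        = (\<Sum>q<p. \<Sum>q'<p. w q x * cnj (w q' x') * g l j (c, q) (c', q')))" for k i w g
  have "\<exists>w g. Q k i w g" for k i
    unfolding Q_def
  proof (rule psd_form_purification_factorization)
    show "card (?X k i) \<le> p" using p[of i k] by (simp add: mult.commute)
    show "psd_form (?C l j \<times> ?X k i) (supermap_kernel dA dB dC S k i l j)" for l j
      by (rule psd_form_supermap_kernel) (use S pos in \<open>simp_all add: det_supermap_def\<close>)
    show "(\<Sum>l\<in>UNIV. \<Sum>\<gamma><dD l. supermap_kernel dA dB dC S k i l j ((\<gamma>, b), x) ((\<gamma>, b'), x'))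
        = (if b = b' then R k i x x' else 0)"
      if "b < dB j" "b' < dB j" "x \<in> ?X k i" "x' \<in> ?X k i" for j b b' x x'
      using marg[of "fst x" k "fst x'" b j b' "snd x" i "snd x'"] that by (auto simp: t_def)
  qed (use pos in auto)
  then obtain w g where Q: "\<And>k i. Q k i (w k i) (g k i)" by metis
  have w: "R k i x x' = (\<Sum>q<p. w k i q x * cnj (w k i q x'))" if "x \<in> ?X k i" "x' \<in> ?X k i" for k i x x'
    using Q[of k i] that unfolding Q_def by blast
  show ?thesis
  proof (rule that[of w g])
    show "(\<Sum>i\<in>UNIV. \<Sum>a<dA i. \<Sum>q<p. w k i q (\<alpha>, a) * cnj (w k i q (\<alpha>', a))) = (if \<alpha> = \<alpha>' then 1 else 0)"
      if "\<alpha> < dC k" "\<alpha>' < dC k" for k \<alpha> \<alpha>'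
      unfolding R1[OF that, symmetric] by (intro sum.cong refl) (use that in \<open>auto simp: w\<close>)
  qed (use Q in \<open>auto simp: Q_def\<close>)
qed

section \<open>Evaluation of the encoder, the inserted channel and the decoder\<close>

lemma inj_block_same [simp]: "inj_block d i M i = M"
  by (simp add: inj_block_def)

lemma kmap_inj_block_index:
  assumes "r < d' j" "s < d' j"
  shows "kmap d d' g (inj_block d i M) j $$ (r, s) = (\<Sum>a<d i. \<Sum>b<d i. M $$ (a, b) * g j i (r, a) (s, b))"
proof -
  have "kmap d d' g (inj_block d i M) j $$ (r, s)
      = (\<Sum>a<d i. \<Sum>b<d i. inj_block d i M i $$ (a, b) * g j i (r, a) (s, b))"
    unfolding kmap_index[where d' = d' and j = j, OF assms]
    by (rule sum_eq_single) (auto simp: inj_block_def intro!: sum.neutral)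
  then show ?thesis by simp
qed

lemma tensor_id_inj_block_index:
  fixes d :: "'i::finite \<Rightarrow> nat"
  assumes F: "lin_map d d' F" and M: "M \<in> carrier_mat (d i * m) (d i * m)"
    and lt: "b < d' j" "b' < d' j" "q < m" "q' < m"
  shows "tensor_id d d' m F (inj_block (\<lambda>i. d i * m) i M) j $$ (b * m + q, b' * m + q')
    = (\<Sum>a<d i. \<Sum>a'<d i. M $$ (a * m + q, a' * m + q') * F (munit d i a a') j $$ (b, b'))"
proof -
  let ?Y = "\<lambda>i'. subblock (d i') m q q' (inj_block (\<lambda>i. d i * m) i M i')"
  have "elem d ?Y" by (simp add: elem_def subblock_def)
  have "tensor_id d d' m F (inj_block (\<lambda>i. d i * m) i M) j $$ (b * m + q, b' * m + q') = F ?Y j $$ (b, b')"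
    using lt by (simp add: tensor_id_def mult_add_less_mult)
  also have "\<dots> = (\<Sum>i'\<in>UNIV. \<Sum>a<d i'. \<Sum>a'<d i'. ?Y i' $$ (a, a') * F (munit d i' a a') j $$ (b, b'))"
    by (rule lin_map_index_expand[OF F \<open>elem d ?Y\<close> lt(1,2)])
  also have "\<dots> = (\<Sum>a<d i. \<Sum>a'<d i. ?Y i $$ (a, a') * F (munit d i a a') j $$ (b, b'))"
    by (rule sum_eq_single)
      (use lt in \<open>auto simp: inj_block_def subblock_def mult_add_less_mult intro!: sum.neutral\<close>)
  also have "\<dots> = (\<Sum>a<d i. \<Sum>a'<d i. M $$ (a * m + q, a' * m + q') * F (munit d i a a') j $$ (b, b'))"
    by (intro sum.cong refl) (simp add: subblock_def)
  finally show ?thesis .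
qed

lemma choi_index:
  assumes "b < d' j" "b' < d' j" "a < d i" "a' < d i"
  shows "choi d d' F (j, i) $$ (b * d i + a, b' * d i + a') = F (munit d i a a') j $$ (b, b')"
  using assms by (simp add: choi_def mult_add_less_mult)

lemma elem_choi: "elem (homdim d d') (choi d d' F)"
  by (auto simp: elem_def homdim_def choi_def)

text \<open>The exchange of sums behind the final identity. On the left, the factored kernel of
  \<open>S\<close> is paired with Choi entries of the inserted channel and with the input; on the
  right, the encoder acts first, then the channel, then the decoder.\<close>

lemma sum_rearrange_comb:
  "(\<Sum>\<alpha>\<in>C. \<Sum>\<alpha>'\<in>C. r \<alpha> \<alpha>' * (\<Sum>(b, a)\<in>B \<times> A. \<Sum>(b', a')\<in>B \<times> A. ff b a b' a' *
      (\<Sum>q\<in>Q. \<Sum>q'\<in>Q. w q \<alpha> a * w' q' \<alpha>' a' * g b q b' q')))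
    = (\<Sum>(b, q)\<in>B \<times> Q. \<Sum>(b', q')\<in>B \<times> Q. (\<Sum>a\<in>A. \<Sum>a'\<in>A. (\<Sum>\<alpha>\<in>C. \<Sum>\<alpha>'\<in>C. r \<alpha> \<alpha>' *
      (w q \<alpha> a * w' q' \<alpha>' a')) * ff b a b' a') * g b q b' q' :: 'a::comm_semiring_0)"
proof -
  let ?t = "\<lambda>\<alpha> \<alpha>' b a b' a' q q'. r \<alpha> \<alpha>' * (ff b a b' a' * (w q \<alpha> a * w' q' \<alpha>' a' * g b q b' q'))"
  have "(\<Sum>\<alpha>\<in>C. \<Sum>\<alpha>'\<in>C. r \<alpha> \<alpha>' * (\<Sum>(b, a)\<in>B \<times> A. \<Sum>(b', a')\<in>B \<times> A. ff b a b' a' *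
      (\<Sum>q\<in>Q. \<Sum>q'\<in>Q. w q \<alpha> a * w' q' \<alpha>' a' * g b q b' q')))
    = (\<Sum>(\<alpha>, \<alpha>', (b, a), (b', a'), q, q')\<in>C \<times> C \<times> (B \<times> A) \<times> (B \<times> A) \<times> Q \<times> Q. ?t \<alpha> \<alpha>' b a b' a' q q')"
    by (simp add: sum_distrib_left split_def sum.cartesian_product')
  also have "\<dots> = (\<Sum>((b, q), (b', q'), a, a', \<alpha>, \<alpha>')\<in>(B \<times> Q) \<times> (B \<times> Q) \<times> A \<times> A \<times> C \<times> C. ?t \<alpha> \<alpha>' b a b' a' q q')"
    by (rule sum.reindex_bij_witness[where
          i = "\<lambda>((b, q), (b', q'), a, a', \<alpha>, \<alpha>'). (\<alpha>, \<alpha>', (b, a), (b', a'), q, q')" and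
          j = "\<lambda>(\<alpha>, \<alpha>', (b, a), (b', a'), q, q'). ((b, q), (b', q'), a, a', \<alpha>, \<alpha>')"]) auto
  also have "\<dots> = (\<Sum>(b, q)\<in>B \<times> Q. \<Sum>(b', q')\<in>B \<times> Q. (\<Sum>a\<in>A. \<Sum>a'\<in>A. (\<Sum>\<alpha>\<in>C. \<Sum>\<alpha>'\<in>C. r \<alpha> \<alpha>' *
      (w q \<alpha> a * w' q' \<alpha>' a')) * ff b a b' a') * g b q b' q')"
    by (simp add: sum_distrib_left sum_distrib_right split_def sum.cartesian_product' mult_ac)
  finally show ?thesis .
qed

theorem theorem1p2:
  fixes dA :: "'i::finite \<Rightarrow> nat" and dB :: "'j::finite \<Rightarrow> nat"
    and dC :: "'k::finite \<Rightarrow> nat" and dD :: "'l::finite \<Rightarrow> nat"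
    and S :: "('j \<times> 'i \<Rightarrow> complex mat) \<Rightarrow> ('l \<times> 'k \<Rightarrow> complex mat)"
  assumes "\<forall>i. dA i > 0" and "\<forall>j. dB j > 0" and "\<forall>k. dC k > 0" and "\<forall>l. dD l > 0"
    and "det_supermap dA dB dC dD S"
  shows "\<exists>dP :: nat. 0 < dP \<and> dP \<le> Max (range (\<lambda>(i, k). dA i * dC k)) \<and>
     (\<exists>E :: ('k \<Rightarrow> complex mat) \<Rightarrow> ('i \<Rightarrow> complex mat).
      \<exists>G :: ('i \<times> 'k \<times> 'j \<Rightarrow> complex mat) \<Rightarrow> ('l \<Rightarrow> complex mat).
        channel dC (\<lambda>i. dA i * dP) E \<and>
        channel (\<lambda>(i, k, j). dB j * dP) dD G \<and>
        (\<forall>F SF. channel dA dB F \<longrightarrow> lin_map dC dD SF \<longrightarrow> choi dC dD SF = S (choi dA dB F) \<longrightarrow>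
           (\<forall>\<rho>. elem dC \<rho> \<longrightarrow>
              SF \<rho> = G (\<lambda>(i, k, j).
                 tensor_id dA dB dP F
                   (inj_block (\<lambda>i'. dA i' * dP) i (E (inj_block dC k (\<rho> k)) i)) j))))"
proof -
  \<comment> \<open>The upper bound itself serves as the memory dimension: it is at least the number
    of indices of each kernel to be purified.\<close>
  define p where "p = Max (range (\<lambda>(i, k). dA i * dC k))"
  have p: "dA i * dC k \<le> p" for i k
    unfolding p_def by (rule Max_ge) (auto intro: rev_image_eqI[where x = "(i, k)"])
  have p0: "0 < p"
    using p[of undefined undefined] assms(1,3) by (metis mult_pos_pos order_less_le_trans)
  obtain w :: "'k \<Rightarrow> 'i \<Rightarrow> nat \<Rightarrow> nat \<times> nat \<Rightarrow> complex"
    and g :: "'k \<Rightarrow> 'i \<Rightarrow> 'l \<Rightarrow> 'j \<Rightarrow> (nat \<times> nat) \<times> nat \<Rightarrow> (nat \<times> nat) \<times> nat \<Rightarrow> complex"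
    where w: "\<And>k \<alpha> \<alpha>'. \<alpha> < dC k \<Longrightarrow> \<alpha>' < dC k \<Longrightarrow>
      (\<Sum>i\<in>UNIV. \<Sum>a<dA i. \<Sum>q<p. w k i q (\<alpha>, a) * cnj (w k i q (\<alpha>', a))) = (if \<alpha> = \<alpha>' then 1 else 0)"
    and g_psd: "\<And>k i l j. psd_form (({..<dD l} \<times> {..<dB j}) \<times> {..<p}) (g k i l j)"
    and g_tr: "\<And>k i j b b' q q'. b < dB j \<Longrightarrow> b' < dB j \<Longrightarrow> q < p \<Longrightarrow> q' < p \<Longrightarrow>
      (\<Sum>l\<in>UNIV. \<Sum>\<gamma><dD l. g k i l j ((\<gamma>, b), q) ((\<gamma>, b'), q')) = (if b = b' \<and> q = q' then 1 else 0)"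
    and g: "\<And>k i l j \<gamma> \<gamma>' b b' \<alpha> \<alpha>' a a'. \<gamma> < dD l \<Longrightarrow> \<gamma>' < dD l \<Longrightarrow> b < dB j \<Longrightarrow> b' < dB j \<Longrightarrow>
      \<alpha> < dC k \<Longrightarrow> \<alpha>' < dC k \<Longrightarrow> a < dA i \<Longrightarrow> a' < dA i \<Longrightarrow>
      supermap_kernel dA dB dC S k i l j ((\<gamma>, b), (\<alpha>, a)) ((\<gamma>', b'), (\<alpha>', a'))
      = (\<Sum>q<p. \<Sum>q'<p. w k i q (\<alpha>, a) * cnj (w k i q' (\<alpha>', a')) * g k i l j ((\<gamma>, b), q) ((\<gamma>', b'), q'))"
    by (rule det_supermap_kernel_factorization[OF assms(5) _ _ _ p]) (use assms in auto)
  \<comment> \<open>Rank-one blocks, with one Kraus operator for each (k, i). The output index r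
    stands for the pair (a, q) = (r div p, r mod p).\<close>
  define eE where "eE i k = (\<lambda>(r, \<alpha>) (s, \<alpha>'). w k i (r mod p) (\<alpha>, r div p) * cnj (w k i (s mod p) (\<alpha>', s div p)))" for i k
  \<comment> \<open>The kernel may depend on both classical labels i and k, since the decoder
    receives them; its quantum input index splits into (b, q).\<close>
  define eG where "eG l = (\<lambda>(i, k, j) (\<gamma>, r) (\<gamma>', s). g k i l j ((\<gamma>, r div p), r mod p) ((\<gamma>', s div p), s mod p))" for l
  let ?dE = "\<lambda>i. dA i * p"
  let ?dG = "\<lambda>(i::'i, k::'k, j). dB j * p"
  let ?E = "kmap dC ?dE eE" and ?G = "kmap ?dG dD eG"
  have "channel dC ?dE ?E"
    unfolding channel_def
  proof (intro conjI lin_map_kmap comp_pos_kmap trace_pres_kmap)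
    fix i k
    show "psd_form ({..<?dE i} \<times> {..<dC k}) (eE i k)"
      by (rule psd_form_gram[where I = "{()}" and w = "\<lambda>_ (r, \<alpha>). w k i (r mod p) (\<alpha>, r div p)"])
        (auto simp: eE_def)
  next
    fix k \<alpha> \<alpha>' assume lt: "\<alpha> < dC k" "\<alpha>' < dC k"
    show "(\<Sum>i\<in>UNIV. \<Sum>r<?dE i. eE i k (r, \<alpha>) (r, \<alpha>')) = (if \<alpha> = \<alpha>' then 1 else 0)"
      unfolding w[OF lt, symmetric] by (simp add: sum_lessThan_mult eE_def)
  qed
  moreover have "channel ?dG dD ?G"
    unfolding channel_def
  proof (intro conjI lin_map_kmap comp_pos_kmap trace_pres_kmap)
    fix l and ikj :: "'i \<times> 'k \<times> 'j"
    obtain i k j where ikj: "ikj = (i, k, j)" by (cases ikj)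
    have "psd_form ({..<dD l} \<times> {..<dB j * p}) (\<lambda>x y. g k i l j ((fst x, snd x div p), snd x mod p)
        ((fst y, snd y div p), snd y mod p))"
      by (rule psd_form_pullback[OF _ g_psd[of l j k i]])
        (use p0 in \<open>auto simp: less_mult_imp_div_less\<close>)
    then show "psd_form ({..<dD l} \<times> {..<?dG ikj}) (eG l ikj)"
      by (simp add: ikj eG_def split_def)
  next
    fix ikj :: "'i \<times> 'k \<times> 'j" and r s assume lt: "r < ?dG ikj" "s < ?dG ikj"
    obtain i k j where ikj: "ikj = (i, k, j)" by (cases ikj)
    have "(\<Sum>l\<in>UNIV. \<Sum>\<gamma><dD l. eG l ikj (\<gamma>, r) (\<gamma>, s))
        = (if r div p = s div p \<and> r mod p = s mod p then 1 else 0)"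
      unfolding ikj eG_def prod.case
      by (rule g_tr) (use lt p0 in \<open>auto simp: ikj less_mult_imp_div_less\<close>)
    also have "r div p = s div p \<and> r mod p = s mod p \<longleftrightarrow> r = s"
      by (metis div_mult_mod_eq)
    finally show "(\<Sum>l\<in>UNIV. \<Sum>\<gamma><dD l. eG l ikj (\<gamma>, r) (\<gamma>, s)) = (if r = s then 1 else 0)" .
  qed
  moreover have "SF \<rho> = ?G (\<lambda>(i, k, j). tensor_id dA dB p F
      (inj_block ?dE i (?E (inj_block dC k (\<rho> k)) i)) j)" (is "_ = kmap _ _ _ ?Y")
    if F: "channel dA dB F" and SF: "lin_map dC dD SF" and ch: "choi dC dD SF = S (choi dA dB F)"
      and \<rho>: "elem dC \<rho>" for F SF \<rho>
  proof
    fix l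
    have linF: "lin_map dA dB F" using F by (simp add: channel_def)
    have linS: "lin_map (homdim dA dB) (homdim dC dD) S" using assms(5) by (simp add: det_supermap_def)
    define f where "f i j b a b' a' = F (munit dA i a a') j $$ (b, b')" for i j b a b' a'
    have SFl: "SF \<rho> l \<in> carrier_mat (dD l) (dD l)" by (rule lin_map_carrier[OF SF \<rho>])
    show "SF \<rho> l = ?G ?Y l"
    proof (rule eq_matI)
      fix \<gamma> \<gamma>' assume "\<gamma> < dim_row (?G ?Y l)" "\<gamma>' < dim_col (?G ?Y l)"
      then have lt: "\<gamma> < dD l" "\<gamma>' < dD l" by (auto simp: kmap_def)
      let ?g = "\<lambda>k i j b q b' q'. g k i l j ((\<gamma>, b), q) ((\<gamma>', b'), q')"
      \<comment> \<open>The share of block (j, i) of J(F) in a Choi entry of \<open>SF\<close>, with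
        the factored kernel of \<open>S\<close> inserted.\<close>
      define h where "h k i j \<alpha> \<alpha>' = (\<Sum>(b, a)\<in>{..<dB j} \<times> {..<dA i}. \<Sum>(b', a')\<in>{..<dB j} \<times> {..<dA i}. f i j b a b' a' *
            (\<Sum>q<p. \<Sum>q'<p. w k i q (\<alpha>, a) * cnj (w k i q' (\<alpha>', a')) * ?g k i j b q b' q'))" for k i j \<alpha> \<alpha>'
      \<comment> \<open>An entry of block (i, k, j) of the intermediate element \<omega>; the sum
        over \<alpha> and \<alpha>' is an entry of the encoder output.\<close>
      let ?y = "\<lambda>i k j b q b' q'. \<Sum>a<dA i. \<Sum>a'<dA i. (\<Sum>\<alpha><dC k. \<Sum>\<alpha>'<dC k. \<rho> k $$ (\<alpha>, \<alpha>') *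
            (w k i q (\<alpha>, a) * cnj (w k i q' (\<alpha>', a')))) * f i j b a b' a'"
      have SFm: "SF (munit dC k \<alpha> \<alpha>') l $$ (\<gamma>, \<gamma>') = (\<Sum>j\<in>UNIV. \<Sum>i\<in>UNIV. h k i j \<alpha> \<alpha>')"
        if a: "\<alpha> < dC k" "\<alpha>' < dC k" for k \<alpha> \<alpha>'
      proof -
        have "SF (munit dC k \<alpha> \<alpha>') l $$ (\<gamma>, \<gamma>') = S (choi dA dB F) (l, k) $$ (\<gamma> * dC k + \<alpha>, \<gamma>' * dC k + \<alpha>')"
          unfolding ch[symmetric] by (rule choi_index[symmetric]) (use lt a in auto)
        also have "\<dots> = (\<Sum>j\<in>UNIV. \<Sum>i\<in>UNIV. h k i j \<alpha> \<alpha>')"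
          unfolding supermap_index_expand[OF linS elem_choi lt a]
          by (intro sum.cong refl) (use lt a in \<open>auto simp: h_def choi_index f_def g intro!: sum.cong\<close>)
        finally show ?thesis .
      qed
      have y: "?y i k j b q b' q' * ?g k i j b q b' q'
          = tensor_id dA dB p F (inj_block ?dE i (?E (inj_block dC k (\<rho> k)) i)) j $$ (b * p + q, b' * p + q')
            * eG l (i, k, j) (\<gamma>, b * p + q) (\<gamma>', b' * p + q')"
        if bq: "b < dB j" "b' < dB j" "q < p" "q' < p" for i k j b q b' q'
      proof -
        have carr: "?E (inj_block dC k (\<rho> k)) i \<in> carrier_mat (dA i * p) (dA i * p)"
          by (simp add: kmap_def)
        have "tensor_id dA dB p F (inj_block ?dE i (?E (inj_block dC k (\<rho> k)) i)) j $$ (b * p + q, b' * p + q')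
            = ?y i k j b q b' q'"
          unfolding tensor_id_inj_block_index[OF linF carr bq] f_def
          by (intro sum.cong refl, subst kmap_inj_block_index)
            (use bq in \<open>auto simp: mult_add_less_mult eE_def\<close>)
        then show ?thesis using bq by (simp add: eG_def)
      qed
      have "SF \<rho> l $$ (\<gamma>, \<gamma>') = (\<Sum>k\<in>UNIV. \<Sum>\<alpha><dC k. \<Sum>\<alpha>'<dC k. \<rho> k $$ (\<alpha>, \<alpha>') * SF (munit dC k \<alpha> \<alpha>') l $$ (\<gamma>, \<gamma>'))"
        by (rule lin_map_index_expand[OF SF \<rho> lt])
      also have "\<dots> = (\<Sum>k\<in>UNIV. \<Sum>\<alpha><dC k. \<Sum>\<alpha>'<dC k. \<Sum>j\<in>UNIV. \<Sum>i\<in>UNIV. \<rho> k $$ (\<alpha>, \<alpha>') * h k i j \<alpha> \<alpha>')"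
        by (intro sum.cong refl) (simp add: SFm sum_distrib_left)
      also have "\<dots> = (\<Sum>k\<in>UNIV. \<Sum>(\<alpha>, \<alpha>')\<in>{..<dC k} \<times> {..<dC k}. \<Sum>(j, i)\<in>UNIV \<times> UNIV. \<rho> k $$ (\<alpha>, \<alpha>') * h k i j \<alpha> \<alpha>')"
        unfolding sum.cartesian_product[symmetric] ..
      also have "\<dots> = (\<Sum>k\<in>UNIV. \<Sum>(j, i)\<in>UNIV \<times> UNIV. \<Sum>(\<alpha>, \<alpha>')\<in>{..<dC k} \<times> {..<dC k}. \<rho> k $$ (\<alpha>, \<alpha>') * h k i j \<alpha> \<alpha>')"
        unfolding split_def by (intro sum.cong refl sum.swap)
      also have "\<dots> = (\<Sum>k\<in>UNIV. \<Sum>j\<in>UNIV. \<Sum>i\<in>UNIV. \<Sum>\<alpha><dC k. \<Sum>\<alpha>'<dC k. \<rho> k $$ (\<alpha>, \<alpha>') * h k i j \<alpha> \<alpha>')"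
        unfolding sum.cartesian_product[symmetric] ..
      \<comment> \<open>Block by block, the order of summation passes from \<open>S\<close> applied
        to J(F) to the sequential composition in the comb.\<close>
      also have "\<dots> = (\<Sum>k\<in>UNIV. \<Sum>j\<in>UNIV. \<Sum>i\<in>UNIV. \<Sum>(b, q)\<in>{..<dB j} \<times> {..<p}. \<Sum>(b', q')\<in>{..<dB j} \<times> {..<p}.
          ?y i k j b q b' q' * ?g k i j b q b' q')"
        unfolding h_def by (intro sum.cong refl, rule sum_rearrange_comb)
      also have "\<dots> = (\<Sum>k\<in>UNIV. \<Sum>i\<in>UNIV. \<Sum>j\<in>UNIV. \<Sum>(b, q)\<in>{..<dB j} \<times> {..<p}. \<Sum>(b', q')\<in>{..<dB j} \<times> {..<p}.
          ?y i k j b q b' q' * ?g k i j b q b' q')"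
        by (intro sum.cong refl sum.swap)
      also have "\<dots> = (\<Sum>i\<in>UNIV. \<Sum>k\<in>UNIV. \<Sum>j\<in>UNIV. \<Sum>(b, q)\<in>{..<dB j} \<times> {..<p}. \<Sum>(b', q')\<in>{..<dB j} \<times> {..<p}.
          ?y i k j b q b' q' * ?g k i j b q b' q')"
        by (rule sum.swap)
      also have "\<dots> = (\<Sum>i\<in>UNIV. \<Sum>k\<in>UNIV. \<Sum>j\<in>UNIV. \<Sum>r<dB j * p. \<Sum>s<dB j * p. ?Y (i, k, j) $$ (r, s) * eG l (i, k, j) (\<gamma>, r) (\<gamma>', s))"
        unfolding sum_lessThan_mult_pairs prod.case split_def
        by (intro sum.cong refl) (auto intro!: y)
      also have "\<dots> = (\<Sum>ikj\<in>UNIV \<times> UNIV \<times> UNIV. \<Sum>r<?dG ikj. \<Sum>s<?dG ikj. ?Y ikj $$ (r, s) * eG l ikj (\<gamma>, r) (\<gamma>', s))"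
        unfolding sum.cartesian_product' prod.case ..
      also have "\<dots> = ?G ?Y l $$ (\<gamma>, \<gamma>')"
        unfolding UNIV_Times_UNIV by (rule kmap_index[where d' = dD and j = l, OF lt, symmetric])
      finally show "SF \<rho> l $$ (\<gamma>, \<gamma>') = ?G ?Y l $$ (\<gamma>, \<gamma>')" .
    qed (use SFl in \<open>auto simp: kmap_def\<close>)
  qed
  ultimately show ?thesis
    using p0 unfolding p_def[symmetric] by blast
qed

end
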